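(* Let $f(x,y)=f_1x+f_2y$ and $g(x,y)=g_1x+g_2y$ be nonzero linear functions with $f_1,f_2,g_1,g_2\in\mathbb{Z}$, let $b$ be a positive integer, and let $S=\{v\in\mathbb{N}^2\mid f(v)\bmod b\le g(v)\}$. Assume that $g_1g_2\le 0$, that $g_1$ and $g_2$ are not both $\le 0$, and that $S\ne\mathbb{N}^2$. Then $S$ is Cohen-Macaulay.
   Context: $\mathbb{N}$ is the set of non-negative integers; for an integer $a$ and a positive integer $b$, $a\bmod b\in\{0,\dots,b-1\}$ is the remainder of the Euclidean division of $a$ by $b$. The set $S$ is a finitely generated submonoid of $\mathbb{N}^2$. For a field $\mathbf{k}$, $\mathbf{k}[S]=\bigoplus_{m\in S}\mathbf{k}\chi^m$ is the semigroup ring with $\mathbf{k}$-linear multiplication determined by $\chi^m\cdot\chi^n=\chi^{m+n}$. $S$ is called Cohen-Macaulay if $\mathbf{k}[S]$ is a Cohen-Macaulay ring. *)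

theory Defs
  imports
    "HOL-Algebra.Ring_Divisibility"
    "HOL-Library.Extended_Nat"
    "HOL-Library.Poly_Mapping"
    "HOL-Library.Product_Plus"
begin

section \<open>Localization of a commutative ring\<close>

text \<open>
  The ring of fractions of \<open>R\<close> with denominators in a multiplicatively closed subset \<open>T\<close> containing \<open>1\<close>.
  Its elements are classes of pairs \<open>(a, s)\<close>, to be read as \<open>a / s\<close>; the extra factor \<open>u\<close> is what
  makes the relation transitive when \<open>R\<close> has zero divisors.
\<close>

definition frac_rel :: "('a, 'm) ring_scheme \<Rightarrow> 'a set \<Rightarrow> (('a \<times> 'a) \<times> ('a \<times> 'a)) set" where
  "frac_rel R T = {((a, s), (b, t)).
     a \<in> carrier R \<and> s \<in> T \<and> b \<in> carrier R \<and> t \<in> T \<and>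
     (\<exists>u\<in>T. u \<otimes>\<^bsub>R\<^esub> (t \<otimes>\<^bsub>R\<^esub> a) = u \<otimes>\<^bsub>R\<^esub> (s \<otimes>\<^bsub>R\<^esub> b))}"

definition ring_frac :: "('a, 'm) ring_scheme \<Rightarrow> 'a set \<Rightarrow> 'a \<Rightarrow> 'a \<Rightarrow> ('a \<times> 'a) set" where
  "ring_frac R T a s = frac_rel R T `` {(a, s)}"

definition localization :: "('a, 'm) ring_scheme \<Rightarrow> 'a set \<Rightarrow> ('a \<times> 'a) set ring" where
  "localization R T =
    \<lparr> carrier = (carrier R \<times> T) // frac_rel R T,
      mult = (\<lambda>X Y. \<Union>(a, s)\<in>X. \<Union>(b, t)\<in>Y. ring_frac R T (a \<otimes>\<^bsub>R\<^esub> b) (s \<otimes>\<^bsub>R\<^esub> t)),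
      one = ring_frac R T \<one>\<^bsub>R\<^esub> \<one>\<^bsub>R\<^esub>,
      zero = ring_frac R T \<zero>\<^bsub>R\<^esub> \<one>\<^bsub>R\<^esub>,
      add = (\<lambda>X Y. \<Union>(a, s)\<in>X. \<Union>(b, t)\<in>Y.
               ring_frac R T ((t \<otimes>\<^bsub>R\<^esub> a) \<oplus>\<^bsub>R\<^esub> (s \<otimes>\<^bsub>R\<^esub> b)) (s \<otimes>\<^bsub>R\<^esub> t)) \<rparr>"

section \<open>Krull dimension, depth and Cohen-Macaulay rings\<close>

definition prime_chain :: "('a, 'm) ring_scheme \<Rightarrow> 'a set list \<Rightarrow> bool" where
  "prime_chain R Ps \<longleftrightarrow> Ps \<noteq> [] \<and> (\<forall>P\<in>set Ps. primeideal P R) \<and> sorted_wrt (\<subset>) Ps"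

text \<open>A chain of \<open>n + 1\<close> primes has length \<open>n\<close>. The zero ring gets dimension \<open>0\<close>.\<close>

definition krull_dim :: "('a, 'm) ring_scheme \<Rightarrow> enat" where
  "krull_dim R = (SUP Ps\<in>{Ps. prime_chain R Ps}. enat (length Ps - 1))"

text \<open>
  Each \<open>xs ! i\<close> is a nonzerodivisor on the quotient of \<open>R\<close> by the ideal generated by its
  predecessors, and the whole sequence generates a proper ideal.
\<close>

definition regular_sequence :: "('a, 'm) ring_scheme \<Rightarrow> 'a list \<Rightarrow> bool" where
  "regular_sequence R xs \<longleftrightarrow>
     set xs \<subseteq> carrier R \<and>
     (\<forall>i<length xs. \<forall>a\<in>carrier R.
        xs ! i \<otimes>\<^bsub>R\<^esub> a \<in> genideal R (set (take i xs)) \<longrightarrow> a \<in> genideal R (set (take i xs))) \<and>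
     genideal R (set xs) \<noteq> carrier R"

definition depth :: "('a, 'm) ring_scheme \<Rightarrow> 'a set \<Rightarrow> enat" where
  "depth R I = (SUP xs\<in>{xs. regular_sequence R xs \<and> set xs \<subseteq> I}. enat (length xs))"

definition cohen_macaulay_local_ring :: "('a, 'm) ring_scheme \<Rightarrow> bool" where
  "cohen_macaulay_local_ring R \<longleftrightarrow>
     cring R \<and> noetherian_ring R \<and>
     (\<exists>M. (\<forall>N. maximalideal N R \<longleftrightarrow> N = M) \<and> depth R M = krull_dim R)"

definition cohen_macaulay_ring :: "('a, 'm) ring_scheme \<Rightarrow> bool" where
  "cohen_macaulay_ring R \<longleftrightarrow>
     cring R \<and> noetherian_ring R \<and>
     (\<forall>M. maximalideal M R \<longrightarrow> cohen_macaulay_local_ring (localization R (carrier R - M)))"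

section \<open>Semigroup rings\<close>

text \<open>
  \<open>Poly_Mapping.single m 1\<close> plays the role of the basis element \<open>\<chi>\<^sup>m\<close>; the product of
  finitely supported functions is convolution, so \<open>\<chi>\<^sup>m \<chi>\<^sup>n = \<chi>\<^sup>m\<^sup>+\<^sup>n\<close>.
  The result is a ring exactly when \<open>S\<close> is a submonoid.
\<close>

definition semigroup_ring :: "(nat \<times> nat) set \<Rightarrow> ((nat \<times> nat) \<Rightarrow>\<^sub>0 'k::field) ring" where
  "semigroup_ring S =
    \<lparr> carrier = {p. Poly_Mapping.keys p \<subseteq> S}, mult = (*), one = 1, zero = 0, add = (+) \<rparr>"

text \<open>
  The coefficient field is a type, passed explicitly because it does not occur in \<open>S\<close>.
  That \<open>S\<close> is a finitely generated submonoid need not be required separately: \<^const>\<open>cring\<close> and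
  \<^const>\<open>noetherian_ring\<close> in \<^const>\<open>cohen_macaulay_ring\<close> force it.
\<close>

definition cohen_macaulay_semigroup :: "'k::field itself \<Rightarrow> (nat \<times> nat) set \<Rightarrow> bool" where
  "cohen_macaulay_semigroup _ S \<longleftrightarrow>
     cohen_macaulay_ring (semigroup_ring S :: ((nat \<times> nat) \<Rightarrow>\<^sub>0 'k) ring)"

section \<open>Linear functions with integer coefficients on pairs of naturals\<close>

definition lin :: "int \<Rightarrow> int \<Rightarrow> nat \<times> nat \<Rightarrow> int" where
  "lin c d v = c * int (fst v) + d * int (snd v)"

end

theory Submission
  imports Defs
begin

text \<open>
  Suppose \<open>g\<^sub>1 > 0 \<ge> g\<^sub>2\<close>; the other case is its mirror image. Put \<open>e\<^sub>1 = (b, 0)\<close> and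
  \<open>e\<^sub>2 = (- b g\<^sub>2, b g\<^sub>1)\<close>. Both are congruent to \<open>0\<close> modulo \<open>b\<close>, so translating by them does not change
  \<open>f mod b\<close>, and \<open>g e\<^sub>2 = 0\<close>, so translating by \<open>e\<^sub>2\<close> does not change the defining inequality at all.
  Two consequences are, besides its being a monoid, all that is used about \<open>S\<close> (locale \<open>cm_plane_monoid\<close>, lemma
  \<open>cm_plane_monoid_of_inequality\<close>): \<open>S\<close> is covered by finitely many translates of
  \<open>\<nat> e\<^sub>1 + \<nat> e\<^sub>2\<close>, and a lattice point that reaches \<open>S\<close> both by adding a multiple of \<open>e\<^sub>1\<close> and by
  adding a multiple of \<open>e\<^sub>2\<close> is itself in \<open>S\<close>. The latter is the combinatorial form of the
  Cohen-Macaulay property.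

  The ring \<open>k[S]\<close> is noetherian because, by Dickson's lemma, the leading exponents of an ideal
  are generated by finitely many of them. Its dimension is at most \<open>2\<close>: any three polynomials in two
  variables are algebraically dependent over the field, and reading off the lowest coefficients of such a
  relation along a chain of four primes would put a nonzero constant into the last one.

  For the depth, let \<open>M\<close> be a maximal ideal. The residue field is finite-dimensional over \<open>k\<close>
  (\<open>residue_field_finite_dimensional\<close>), so \<open>M\<close> contains a nonzero polynomial \<open>p\<close> in
  \<open>\<chi>\<^bsup>e1\<^esup>\<close> and a nonzero polynomial \<open>q\<close> in \<open>\<chi>\<^bsup>e2\<^esup>\<close>. These two form a regular sequence: division by
  \<open>p\<close>, of degree \<open>n\<close>, leaves remainders supported on the points of \<open>S\<close> that are not in \<open>S + n e\<^sub>1\<close>,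
  such a remainder is a multiple of \<open>p\<close> only if it is \<open>0\<close>, and by the property of \<open>S\<close> above this set of points is
  stable under adding \<open>e\<^sub>2\<close>, so that multiplication by \<open>q\<close> preserves remainders.

  Regular sequences inside \<open>M\<close> stay regular in the localization at \<open>M\<close>, and prime chains of the localization
  contract to prime chains of \<open>k[S]\<close>. Hence depth \<open>\<ge> 2 \<ge>\<close> dimension at every maximal ideal; the inequality
  depth \<open>\<le>\<close> dimension holds in every commutative ring (\<open>depth_le_krull_dim\<close>).
\<close>

section \<open>Localization\<close>

locale mult_closed_subset = cring R for R (structure) +
  fixes T :: "'a set"
  assumes subset: "T \<subseteq> carrier R"
    and one_mem [simp, intro]: "\<one> \<in> T"
    and mult_mem [simp, intro]: "\<lbrakk>s \<in> T; t \<in> T\<rbrakk> \<Longrightarrow> s \<otimes> t \<in> T"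
begin

abbreviation "fraction \<equiv> ring_frac R T"
abbreviation "Loc \<equiv> localization R T"

lemma mem_carrier [simp, intro]: "t \<in> T \<Longrightarrow> t \<in> carrier R"
  using subset by blast

lemma frac_rel_iff:
  "((a, s), (b, t)) \<in> frac_rel R T \<longleftrightarrow>
     a \<in> carrier R \<and> s \<in> T \<and> b \<in> carrier R \<and> t \<in> T \<and>
     (\<exists>u\<in>T. u \<otimes> (t \<otimes> a) = u \<otimes> (s \<otimes> b))"
  by (simp add: frac_rel_def)

lemma frac_rel_equiv: "equiv (carrier R \<times> T) (frac_rel R T)"
proof (rule equivI)
  show "frac_rel R T \<subseteq> (carrier R \<times> T) \<times> (carrier R \<times> T)"
    by (auto simp: frac_rel_def)
  show "refl_on (carrier R \<times> T) (frac_rel R T)"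
    by (auto simp: refl_on_def frac_rel_def)
  show "sym (frac_rel R T)"
    by (auto simp: sym_def frac_rel_def) metis
  show "trans (frac_rel R T)"
  proof (rule transI, clarify)
    fix a s b t c r
    assume "((a, s), (b, t)) \<in> frac_rel R T" "((b, t), (c, r)) \<in> frac_rel R T"
    then obtain u v where mem: "a \<in> carrier R" "b \<in> carrier R" "c \<in> carrier R"
        "s \<in> T" "t \<in> T" "r \<in> T" "u \<in> T" "v \<in> T"
      and u: "u \<otimes> (t \<otimes> a) = u \<otimes> (s \<otimes> b)" and v: "v \<otimes> (r \<otimes> b) = v \<otimes> (t \<otimes> c)"
      unfolding frac_rel_iff by blast
    have "(u \<otimes> v \<otimes> t) \<otimes> (r \<otimes> a) = (v \<otimes> r) \<otimes> (u \<otimes> (t \<otimes> a))"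
      using mem by (simp add: m_ac)
    also have "\<dots> = (u \<otimes> s) \<otimes> (v \<otimes> (r \<otimes> b))"
      unfolding u using mem by (simp add: m_ac)
    also have "\<dots> = (u \<otimes> v \<otimes> t) \<otimes> (s \<otimes> c)"
      unfolding v using mem by (simp add: m_ac)
    finally show "((a, s), (c, r)) \<in> frac_rel R T"
      unfolding frac_rel_iff using mem by blast
  qed
qed

lemma frac_eq_iff:
  assumes "a \<in> carrier R" "s \<in> T" "b \<in> carrier R" "t \<in> T"
  shows "fraction a s = fraction b t \<longleftrightarrow> (\<exists>u\<in>T. u \<otimes> (t \<otimes> a) = u \<otimes> (s \<otimes> b))"
  using eq_equiv_class_iff[OF frac_rel_equiv, of "(a, s)" "(b, t)"] assms
  by (simp add: ring_frac_def frac_rel_iff)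

lemma frac_eqI:
  assumes "a \<in> carrier R" "s \<in> T" "b \<in> carrier R" "t \<in> T" "t \<otimes> a = s \<otimes> b"
  shows "fraction a s = fraction b t"
  using assms by (auto simp: frac_eq_iff intro!: bexI[of _ \<one>])

lemma frac_cancel:
  assumes "a \<in> carrier R" "s \<in> T" "t \<in> T"
  shows "fraction (t \<otimes> a) (t \<otimes> s) = fraction a s"
  using assms by (intro frac_eqI) (auto simp: m_ac)

lemma frac_mem: "\<lbrakk>a \<in> carrier R; s \<in> T\<rbrakk> \<Longrightarrow> fraction a s \<in> carrier Loc"
  by (auto simp: localization_def ring_frac_def intro!: quotientI)

lemma carrier_LocE:
  assumes "x \<in> carrier Loc"
  obtains a s where "a \<in> carrier R" "s \<in> T" "x = fraction a s"
  using assms by (auto simp: localization_def ring_frac_def elim!: quotientE)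

lemma one_Loc: "\<one>\<^bsub>Loc\<^esub> = fraction \<one> \<one>"
  by (simp add: localization_def)

lemma zero_Loc: "\<zero>\<^bsub>Loc\<^esub> = fraction \<zero> \<one>"
  by (simp add: localization_def)

lemma mem_frac_iff: "(b, t) \<in> fraction a s \<longleftrightarrow> ((a, s), (b, t)) \<in> frac_rel R T"
  by (simp add: ring_frac_def)

text \<open>
  Sums and products in a localization are unions over all representatives. Where the summand
  depends only on the two classes, the union collapses to a single value.
\<close>

lemma Union_frac:
  assumes "a \<in> carrier R" "s \<in> T" "b \<in> carrier R" "t \<in> T"
    and const: "\<And>a' s' b' t'. \<lbrakk>a' \<in> carrier R; s' \<in> T; b' \<in> carrier R; t' \<in> T;
                 fraction a' s' = fraction a s; fraction b' t' = fraction b t\<rbrakk> \<Longrightarrow> h a' s' b' t' = h a s b t"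
  shows "(\<Union>(a', s')\<in>fraction a s. \<Union>(b', t')\<in>fraction b t. h a' s' b' t') = h a s b t"
proof -
  have *: "a' \<in> carrier R \<and> s' \<in> T \<and> fraction a' s' = fraction a s"
    if "(a', s') \<in> fraction a s" for a a' s s'
    using that eq_equiv_class_iff[OF frac_rel_equiv, of "(a, s)" "(a', s')"]
    by (auto simp: mem_frac_iff frac_rel_iff ring_frac_def)
  have "(a, s) \<in> fraction a s" "(b, t) \<in> fraction b t"
    using assms by (auto simp: mem_frac_iff frac_rel_iff)
  moreover have "h a' s' b' t' = h a s b t"
    if "(a', s') \<in> fraction a s" "(b', t') \<in> fraction b t" for a' s' b' t'
    using *[OF that(1)] *[OF that(2)] const by blast
  ultimately show ?thesis by blast
qed

lemma mult_Loc:
  assumes "a \<in> carrier R" "s \<in> T" "b \<in> carrier R" "t \<in> T"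
  shows "fraction a s \<otimes>\<^bsub>Loc\<^esub> fraction b t = fraction (a \<otimes> b) (s \<otimes> t)"
proof -
  have *: "fraction (a' \<otimes> b') (s' \<otimes> t') = fraction (a \<otimes> b) (s \<otimes> t)"
    if mem: "a' \<in> carrier R" "s' \<in> T" "b' \<in> carrier R" "t' \<in> T"
      and eq: "fraction a' s' = fraction a s" "fraction b' t' = fraction b t" for a' s' b' t'
  proof -
    obtain u v where uv: "u \<in> T" "v \<in> T"
      and u: "u \<otimes> (s \<otimes> a') = u \<otimes> (s' \<otimes> a)" and v: "v \<otimes> (t \<otimes> b') = v \<otimes> (t' \<otimes> b)"
      using eq[unfolded frac_eq_iff[OF mem(1,2) assms(1,2)] frac_eq_iff[OF mem(3,4) assms(3,4)]]
      by (elim bexE) (rule that)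
    have "(u \<otimes> v) \<otimes> ((s \<otimes> t) \<otimes> (a' \<otimes> b')) = (u \<otimes> (s \<otimes> a')) \<otimes> (v \<otimes> (t \<otimes> b'))"
      using mem uv assms by (simp add: m_ac)
    also have "\<dots> = (u \<otimes> v) \<otimes> ((s' \<otimes> t') \<otimes> (a \<otimes> b))"
      unfolding u v using mem uv assms by (simp add: m_ac)
    finally show ?thesis using mem uv assms by (auto simp: frac_eq_iff)
  qed
  show ?thesis
    unfolding localization_def ring.simps partial_object.simps monoid.simps
    by (rule Union_frac[OF assms]) (rule *)
qed

lemma add_Loc:
  assumes "a \<in> carrier R" "s \<in> T" "b \<in> carrier R" "t \<in> T"
  shows "fraction a s \<oplus>\<^bsub>Loc\<^esub> fraction b t = fraction (t \<otimes> a \<oplus> s \<otimes> b) (s \<otimes> t)"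
proof -
  have *: "fraction (t' \<otimes> a' \<oplus> s' \<otimes> b') (s' \<otimes> t') = fraction (t \<otimes> a \<oplus> s \<otimes> b) (s \<otimes> t)"
    if mem: "a' \<in> carrier R" "s' \<in> T" "b' \<in> carrier R" "t' \<in> T"
      and eq: "fraction a' s' = fraction a s" "fraction b' t' = fraction b t" for a' s' b' t'
  proof -
    obtain u v where uv: "u \<in> T" "v \<in> T"
      and u: "u \<otimes> (s \<otimes> a') = u \<otimes> (s' \<otimes> a)" and v: "v \<otimes> (t \<otimes> b') = v \<otimes> (t' \<otimes> b)"
      using eq[unfolded frac_eq_iff[OF mem(1,2) assms(1,2)] frac_eq_iff[OF mem(3,4) assms(3,4)]]
      by (elim bexE) (rule that)
    have "(u \<otimes> v) \<otimes> ((s \<otimes> t) \<otimes> (t' \<otimes> a' \<oplus> s' \<otimes> b'))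
        = (v \<otimes> t \<otimes> t') \<otimes> (u \<otimes> (s \<otimes> a')) \<oplus> (u \<otimes> s \<otimes> s') \<otimes> (v \<otimes> (t \<otimes> b'))"
      using mem uv assms by (simp add: m_ac r_distr)
    also have "\<dots> = (u \<otimes> v) \<otimes> ((s' \<otimes> t') \<otimes> (t \<otimes> a \<oplus> s \<otimes> b))"
      unfolding u v using mem uv assms by (simp add: m_ac r_distr)
    finally show ?thesis using mem uv assms by (auto simp: frac_eq_iff)
  qed
  show ?thesis
    unfolding localization_def ring.simps partial_object.simps monoid.simps
    by (rule Union_frac[OF assms]) (rule *)
qed

lemma cring_Loc: "cring Loc"
proof (rule cringI)
  show "abelian_group Loc"
  proof (rule abelian_groupI)
    fix x y z assume x: "x \<in> carrier Loc" and y: "y \<in> carrier Loc" and z: "z \<in> carrier Loc"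
    obtain a s where a: "a \<in> carrier R" "s \<in> T" "x = fraction a s" using x by (rule carrier_LocE)
    obtain b t where b: "b \<in> carrier R" "t \<in> T" "y = fraction b t" using y by (rule carrier_LocE)
    obtain c r where c: "c \<in> carrier R" "r \<in> T" "z = fraction c r" using z by (rule carrier_LocE)
    note * = a b c
    show "x \<oplus>\<^bsub>Loc\<^esub> y \<in> carrier Loc" using * by (simp add: add_Loc frac_mem)
    show "x \<oplus>\<^bsub>Loc\<^esub> y = y \<oplus>\<^bsub>Loc\<^esub> x" using * by (simp add: add_Loc a_comm m_comm)
    show "(x \<oplus>\<^bsub>Loc\<^esub> y) \<oplus>\<^bsub>Loc\<^esub> z = x \<oplus>\<^bsub>Loc\<^esub> (y \<oplus>\<^bsub>Loc\<^esub> z)"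
      using * by (simp add: add_Loc r_distr m_ac a_ac)
    show "\<zero>\<^bsub>Loc\<^esub> \<oplus>\<^bsub>Loc\<^esub> x = x" using * by (simp add: zero_Loc add_Loc)
    have "fraction (\<ominus> a) s \<oplus>\<^bsub>Loc\<^esub> x = \<zero>\<^bsub>Loc\<^esub>"
      unfolding zero_Loc a(3) using a(1,2) by (simp add: add_Loc r_minus l_neg) (rule frac_eqI; simp)
    then show "\<exists>y\<in>carrier Loc. y \<oplus>\<^bsub>Loc\<^esub> x = \<zero>\<^bsub>Loc\<^esub>"
      using * by (meson frac_mem a_inv_closed)
  qed (simp add: zero_Loc frac_mem)
  show "comm_monoid Loc"
  proof (rule comm_monoidI)
    fix x y z assume x: "x \<in> carrier Loc" and y: "y \<in> carrier Loc" and z: "z \<in> carrier Loc"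
    obtain a s where a: "a \<in> carrier R" "s \<in> T" "x = fraction a s" using x by (rule carrier_LocE)
    obtain b t where b: "b \<in> carrier R" "t \<in> T" "y = fraction b t" using y by (rule carrier_LocE)
    obtain c r where c: "c \<in> carrier R" "r \<in> T" "z = fraction c r" using z by (rule carrier_LocE)
    note * = a b c
    show "x \<otimes>\<^bsub>Loc\<^esub> y \<in> carrier Loc" using * by (simp add: mult_Loc frac_mem)
    show "x \<otimes>\<^bsub>Loc\<^esub> y = y \<otimes>\<^bsub>Loc\<^esub> x" using * by (simp add: mult_Loc m_comm)
    show "(x \<otimes>\<^bsub>Loc\<^esub> y) \<otimes>\<^bsub>Loc\<^esub> z = x \<otimes>\<^bsub>Loc\<^esub> (y \<otimes>\<^bsub>Loc\<^esub> z)"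
      using * by (simp add: mult_Loc m_ac)
    show "\<one>\<^bsub>Loc\<^esub> \<otimes>\<^bsub>Loc\<^esub> x = x" using * by (simp add: one_Loc mult_Loc)
  qed (simp add: one_Loc frac_mem)
  fix x y z assume x: "x \<in> carrier Loc" and y: "y \<in> carrier Loc" and z: "z \<in> carrier Loc"
  obtain a s where a: "a \<in> carrier R" "s \<in> T" "x = fraction a s" using x by (rule carrier_LocE)
  obtain b t where b: "b \<in> carrier R" "t \<in> T" "y = fraction b t" using y by (rule carrier_LocE)
  obtain c r where c: "c \<in> carrier R" "r \<in> T" "z = fraction c r" using z by (rule carrier_LocE)
  note * = a b c
  show "(x \<oplus>\<^bsub>Loc\<^esub> y) \<otimes>\<^bsub>Loc\<^esub> z = x \<otimes>\<^bsub>Loc\<^esub> z \<oplus>\<^bsub>Loc\<^esub> y \<otimes>\<^bsub>Loc\<^esub> z"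
  proof -
    have "x \<otimes>\<^bsub>Loc\<^esub> z \<oplus>\<^bsub>Loc\<^esub> y \<otimes>\<^bsub>Loc\<^esub> z
        = fraction ((t \<otimes> r) \<otimes> (a \<otimes> c) \<oplus> (s \<otimes> r) \<otimes> (b \<otimes> c)) ((s \<otimes> r) \<otimes> (t \<otimes> r))"
      using * by (simp add: mult_Loc add_Loc)
    also have "(t \<otimes> r) \<otimes> (a \<otimes> c) \<oplus> (s \<otimes> r) \<otimes> (b \<otimes> c)
        = r \<otimes> (c \<otimes> (t \<otimes> a)) \<oplus> r \<otimes> (c \<otimes> (s \<otimes> b))"
      using a(1,2) b(1,2) c(1,2) by (simp add: m_ac)
    also have "\<dots> = r \<otimes> ((t \<otimes> a \<oplus> s \<otimes> b) \<otimes> c)"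
      using a(1,2) b(1,2) c(1,2) by (simp add: r_distr m_comm)
    also have "(s \<otimes> r) \<otimes> (t \<otimes> r) = r \<otimes> ((s \<otimes> t) \<otimes> r)"
      using a(1,2) b(1,2) c(1,2) by (simp add: m_ac)
    also have "fraction (r \<otimes> ((t \<otimes> a \<oplus> s \<otimes> b) \<otimes> c)) (r \<otimes> ((s \<otimes> t) \<otimes> r))
        = (x \<oplus>\<^bsub>Loc\<^esub> y) \<otimes>\<^bsub>Loc\<^esub> z"
      using * by (simp add: frac_cancel mult_Loc add_Loc)
    finally show ?thesis by simp
  qed
qed

sublocale Loc: cring Loc
  by (rule cring_Loc)

lemma frac_hom: "ring_hom_ring R Loc (\<lambda>a. fraction a \<one>)"
  by (rule ring_hom_ringI[OF ring_axioms Loc.ring_axioms])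
    (simp_all add: frac_mem mult_Loc add_Loc one_Loc)

definition contraction :: "('a \<times> 'a) set set \<Rightarrow> 'a set" where
  "contraction J = {a \<in> carrier R. fraction a \<one> \<in> J}"

definition extension :: "'a set \<Rightarrow> ('a \<times> 'a) set set" where
  "extension I = {fraction a s |a s. a \<in> I \<and> s \<in> T}"

lemma contraction_ideal: "ideal J Loc \<Longrightarrow> ideal (contraction J) R"
  unfolding contraction_def by (rule ring_hom_ring.ideal_vimage[OF frac_hom])

lemma contraction_prime: "primeideal P Loc \<Longrightarrow> primeideal (contraction P) R"
  unfolding contraction_def by (rule ring_hom_ring.primeideal_vimage[OF frac_hom is_cring])

lemma frac_mem_ideal_iff:
  assumes "ideal J Loc" "a \<in> carrier R" "s \<in> T"
  shows "fraction a s \<in> J \<longleftrightarrow> a \<in> contraction J"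
proof -
  interpret J: ideal J Loc by fact
  \<comment> \<open>\<open>a / s\<close> and \<open>a / 1\<close> are multiples of each other.\<close>
  have "fraction \<one> s \<otimes>\<^bsub>Loc\<^esub> fraction a \<one> = fraction a s" "fraction s \<one> \<otimes>\<^bsub>Loc\<^esub> fraction a s = fraction a \<one>"
    using assms by (simp_all add: mult_Loc m_comm) (rule frac_eqI; simp add: m_comm)
  then show ?thesis
    using assms J.I_l_closed[of "fraction a \<one>" "fraction \<one> s"] J.I_l_closed[of "fraction a s" "fraction s \<one>"]
    by (auto simp: contraction_def frac_mem)
qed

text \<open>
  Every ideal of the localization is extended. This is what lets finite generation descend to the
  localization and keeps contracted prime chains strict.
\<close>

lemma extension_contraction:
  assumes "ideal J Loc" shows "extension (contraction J) = J"
proof -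
  interpret J: ideal J Loc by fact
  have "x \<in> extension (contraction J)" if x: "x \<in> J" for x
  proof -
    obtain a s where "a \<in> carrier R" "s \<in> T" "x = fraction a s"
      using carrier_LocE J.Icarr[OF x] by blast
    with x show ?thesis using frac_mem_ideal_iff[OF assms]
      by (auto simp: extension_def)
  qed
  then show ?thesis
    using frac_mem_ideal_iff[OF assms] by (auto simp: extension_def contraction_def)
qed

lemma extension_ideal:
  assumes "ideal I R" shows "ideal (extension I) Loc"
proof -
  interpret I: ideal I R by fact
  have mem: "x \<in> carrier Loc" if "x \<in> extension I" for x
    using that by (auto simp: extension_def frac_mem)
  have mult: "x \<otimes>\<^bsub>Loc\<^esub> y \<in> extension I" if x: "x \<in> extension I" and y: "y \<in> carrier Loc" for x y
  proof -
    obtain a s where "a \<in> I" "s \<in> T" "x = fraction a s" using x by (auto simp: extension_def)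
    moreover obtain b t where "b \<in> carrier R" "t \<in> T" "y = fraction b t" using y by (rule carrier_LocE)
    ultimately have "a \<otimes> b \<in> I" "s \<otimes> t \<in> T" "x \<otimes>\<^bsub>Loc\<^esub> y = fraction (a \<otimes> b) (s \<otimes> t)"
      by (simp_all add: mult_Loc I.Icarr I.I_r_closed)
    then show ?thesis unfolding extension_def by blast
  qed
  show ?thesis
  proof (rule idealI[OF Loc.ring_axioms])
    show "subgroup (extension I) (add_monoid Loc)"
    proof (rule Loc.add.subgroupI)
      show "extension I \<subseteq> carrier Loc" using mem by blast
      show "extension I \<noteq> {}" using I.zero_closed unfolding extension_def by blast
      fix x y assume x: "x \<in> extension I" and y: "y \<in> extension I"
      have "\<ominus>\<^bsub>Loc\<^esub> x = x \<otimes>\<^bsub>Loc\<^esub> (\<ominus>\<^bsub>Loc\<^esub> \<one>\<^bsub>Loc\<^esub>)"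
        using mem[OF x] by (simp add: Loc.r_minus)
      then show "\<ominus>\<^bsub>Loc\<^esub> x \<in> extension I" using mult[OF x] by simp
      obtain a s b t where *: "a \<in> I" "s \<in> T" "x = fraction a s" "b \<in> I" "t \<in> T" "y = fraction b t"
        using x y by (auto simp: extension_def)
      then have "t \<otimes> a \<oplus> s \<otimes> b \<in> I" by (auto intro!: I.a_closed I.I_l_closed)
      moreover have "x \<oplus>\<^bsub>Loc\<^esub> y = fraction (t \<otimes> a \<oplus> s \<otimes> b) (s \<otimes> t)"
        using * by (simp add: add_Loc I.Icarr)
      ultimately show "x \<oplus>\<^bsub>Loc\<^esub> y \<in> extension I" using * by (auto simp: extension_def)
    qed
    fix x y assume x: "x \<in> extension I" and y: "y \<in> carrier Loc"
    show "x \<otimes>\<^bsub>Loc\<^esub> y \<in> extension I" using mult[OF x y] .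
    then show "y \<otimes>\<^bsub>Loc\<^esub> x \<in> extension I" using mem[OF x] y by (simp add: Loc.m_comm)
  qed
qed

lemma genideal_frac_image:
  assumes "X \<subseteq> carrier R"
  shows "genideal Loc ((\<lambda>a. fraction a \<one>) ` X) = extension (genideal R X)"
proof
  have "ideal (genideal R X) R" by (rule genideal_ideal[OF assms])
  moreover have "X \<subseteq> genideal R X" by (rule genideal_self[OF assms])
  ultimately show "genideal Loc ((\<lambda>a. fraction a \<one>) ` X) \<subseteq> extension (genideal R X)"
    by (intro Loc.genideal_minimal extension_ideal) (auto simp: extension_def)
next
  let ?J = "genideal Loc ((\<lambda>a. fraction a \<one>) ` X)"
  have sub: "(\<lambda>a. fraction a \<one>) ` X \<subseteq> carrier Loc" using assms by (auto simp: frac_mem)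
  have J: "ideal ?J Loc" by (rule Loc.genideal_ideal[OF sub])
  have "X \<subseteq> contraction ?J"
    using Loc.genideal_self[OF sub] assms by (auto simp: contraction_def)
  then have "genideal R X \<subseteq> contraction ?J"
    by (rule genideal_minimal[OF contraction_ideal[OF J]])
  then show "extension (genideal R X) \<subseteq> ?J"
    using extension_contraction[OF J] by (auto simp: extension_def)
qed

lemma noetherian_Loc:
  assumes "noetherian_ring R" shows "noetherian_ring Loc"
proof (rule Loc.noetherian_ringI)
  fix J assume J: "ideal J Loc"
  obtain X where "X \<subseteq> carrier R" "finite X" "contraction J = genideal R X"
    using noetherian_ring.finetely_gen[OF assms contraction_ideal[OF J]] by blast
  then show "\<exists>A\<subseteq>carrier Loc. finite A \<and> J = genideal Loc A"
    using genideal_frac_image[of X] extension_contraction[OF J]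
    by (intro exI[of _ "(\<lambda>a. fraction a \<one>) ` X"]) (auto simp: frac_mem)
qed

lemma frac_mem_extension_iff:
  assumes I: "ideal I R" and mem: "a \<in> carrier R" "s \<in> T"
  shows "fraction a s \<in> extension I \<longleftrightarrow> (\<exists>u\<in>T. u \<otimes> a \<in> I)"
proof
  interpret I: ideal I R by fact
  assume "fraction a s \<in> extension I"
  then obtain b t where b: "b \<in> I" "t \<in> T" "fraction a s = fraction b t" by (auto simp: extension_def)
  then obtain u where "u \<in> T" "u \<otimes> (t \<otimes> a) = u \<otimes> (s \<otimes> b)"
    using mem I.Icarr by (auto simp: frac_eq_iff)
  then have "(u \<otimes> t) \<otimes> a \<in> I" "u \<otimes> t \<in> T"
    using mem b I.I_l_closed[of b "u \<otimes> s"] I.Icarr by (auto simp: m_assoc)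
  then show "\<exists>u\<in>T. u \<otimes> a \<in> I" by blast
next
  assume "\<exists>u\<in>T. u \<otimes> a \<in> I"
  then obtain u where "u \<in> T" "u \<otimes> a \<in> I" by blast
  moreover have "fraction a s = fraction (u \<otimes> a) (u \<otimes> s)"
    using mem \<open>u \<in> T\<close> by (simp add: frac_cancel)
  ultimately show "fraction a s \<in> extension I" using mem by (auto simp: extension_def)
qed

text \<open>
  Extension of ideals commutes with taking generators, so a relation \<open>x\<^sub>i a / s \<in> (x\<^sub>1, \<dots>)\<close> in the
  localization becomes, after multiplying by some \<open>u \<in> T\<close>, a relation for \<open>u a\<close> in \<open>R\<close>. The ideal \<open>I\<close>
  that avoids \<open>T\<close> keeps the extended ideal proper.
\<close>

lemma regular_sequence_frac:
  assumes xs: "regular_sequence R xs"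
    and I: "ideal I R" "set xs \<subseteq> I" "I \<inter> T = {}"
  shows "regular_sequence Loc (map (\<lambda>a. fraction a \<one>) xs)"
  unfolding regular_sequence_def
proof (intro conjI allI impI ballI)
  interpret I: ideal I R by fact
  have sub: "set xs \<subseteq> carrier R" using xs by (simp add: regular_sequence_def)
  then show "set (map (\<lambda>a. fraction a \<one>) xs) \<subseteq> carrier Loc" by (auto simp: frac_mem)
  have "genideal R (set xs) \<subseteq> I" by (rule genideal_minimal[OF I(1,2)])
  then have "u \<otimes> \<one> \<notin> genideal R (set xs)" if "u \<in> T" for u using I(3) that by auto
  then have "\<one>\<^bsub>Loc\<^esub> \<notin> extension (genideal R (set xs))"
    unfolding one_Loc using frac_mem_extension_iff[OF genideal_ideal[OF sub]] by blast
  then show "genideal Loc (set (map (\<lambda>a. fraction a \<one>) xs)) \<noteq> carrier Loc"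
    using genideal_frac_image[OF sub] Loc.one_closed by (auto simp del: Loc.one_closed)
next
  fix i x
  assume i: "i < length (map (\<lambda>a. fraction a \<one>) xs)" and x: "x \<in> carrier Loc"
  let ?I = "genideal R (set (take i xs))"
  assume *: "map (\<lambda>a. fraction a \<one>) xs ! i \<otimes>\<^bsub>Loc\<^esub> x
          \<in> genideal Loc (set (take i (map (\<lambda>a. fraction a \<one>) xs)))"
  have sub: "set xs \<subseteq> carrier R" using xs by (simp add: regular_sequence_def)
  then have sub': "set (take i xs) \<subseteq> carrier R" by (meson order_trans set_take_subset)
  note I' = genideal_ideal[OF sub']
  obtain a s where a: "a \<in> carrier R" "s \<in> T" "x = fraction a s" using x by (rule carrier_LocE)
  have xi: "xs ! i \<in> carrier R" using sub i by (auto dest: nth_mem)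
  have "fraction (xs ! i \<otimes> a) s \<in> extension ?I"
    using * i a xi by (simp add: take_map genideal_frac_image[OF sub'] mult_Loc)
  then obtain u where u: "u \<in> T" "u \<otimes> (xs ! i \<otimes> a) \<in> ?I"
    using frac_mem_extension_iff[OF I'] a xi by auto
  then have "xs ! i \<otimes> (u \<otimes> a) \<in> ?I" using a xi by (simp add: m_ac)
  then have "u \<otimes> a \<in> ?I" using xs i a u by (auto simp: regular_sequence_def)
  then show "x \<in> genideal Loc (set (take i (map (\<lambda>a. fraction a \<one>) xs)))"
    using a u frac_mem_extension_iff[OF I'] by (auto simp: take_map genideal_frac_image[OF sub'])
qed

lemma contraction_strict_mono:
  assumes "ideal I Loc" "ideal J Loc" "I \<subset> J"
  shows "contraction I \<subset> contraction J"
proof -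
  have "contraction I \<subseteq> contraction J" using assms by (auto simp: contraction_def)
  moreover have "contraction I \<noteq> contraction J"
    using extension_contraction assms by (metis psubset_imp_subset psubsetE)
  ultimately show ?thesis by blast
qed

lemma prime_chain_contraction:
  assumes "prime_chain Loc Ps" shows "prime_chain R (map contraction Ps)"
proof -
  have P: "P \<in> set Ps \<Longrightarrow> primeideal P Loc" for P using assms by (simp add: prime_chain_def)
  have "sorted_wrt (\<lambda>P Q. contraction P \<subset> contraction Q) Ps"
  proof (rule sorted_wrt_mono_rel[of Ps "(\<subset>)"])
    show "sorted_wrt (\<subset>) Ps" using assms by (simp add: prime_chain_def)
    show "contraction I \<subset> contraction J" if "I \<in> set Ps" "J \<in> set Ps" "I \<subset> J" for I J
      using that by (intro contraction_strict_mono[OF primeideal.axioms(1) primeideal.axioms(1)] P)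
  qed
  then show ?thesis
    using assms contraction_prime[OF P] by (simp add: prime_chain_def sorted_wrt_map)
qed

end

lemma (in primeideal) mult_closed_complement: "mult_closed_subset R (carrier R - I)"
proof
  show "\<one> \<in> carrier R - I" using I_notcarr one_imp_carrier by blast
  show "s \<otimes> t \<in> carrier R - I" if "s \<in> carrier R - I" "t \<in> carrier R - I" for s t
    using that I_prime[of s t] by blast
qed blast

text \<open>
  A fraction whose numerator lies outside the prime is a unit, so every proper ideal of the
  localization is contained in the extension of the prime.
\<close>

lemma (in primeideal) maximalideal_localization_iff:
  "maximalideal N (localization R (carrier R - I)) \<longleftrightarrow>
     N = mult_closed_subset.extension R (carrier R - I) I"
proof -
  interpret T: mult_closed_subset R "carrier R - I" by (rule mult_closed_complement)
  let ?M = "T.extension I"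
  have M: "ideal ?M T.Loc" by (rule T.extension_ideal[OF is_ideal])
  have "\<one>\<^bsub>T.Loc\<^esub> \<notin> ?M"
    unfolding T.one_Loc T.frac_mem_extension_iff[OF is_ideal one_closed T.one_mem] by simp
  then have proper: "?M \<noteq> carrier T.Loc" using T.Loc.one_closed by metis
  have le: "J \<subseteq> ?M" if J: "ideal J T.Loc" "J \<noteq> carrier T.Loc" for J
  proof
    interpret J: ideal J T.Loc by fact
    fix x assume x: "x \<in> J"
    obtain a s where a: "a \<in> carrier R" "s \<in> carrier R - I" "x = T.fraction a s"
      using T.carrier_LocE[OF J.Icarr[OF x]] .
    have "a \<in> I"
    proof (rule ccontr)
      assume "a \<notin> I"
      with a have mem: "a \<in> carrier R - I" "s \<in> carrier R" by auto
      have "T.fraction s a \<otimes>\<^bsub>T.Loc\<^esub> x = T.fraction (s \<otimes> a) (a \<otimes> s)"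
        unfolding a(3) by (rule T.mult_Loc[OF mem(2,1) a(1,2)])
      also have "\<dots> = \<one>\<^bsub>T.Loc\<^esub>"
        unfolding T.one_Loc
        by (rule T.frac_eqI) (use mem a(2) T.mult_mem T.one_mem in \<open>auto simp: m_comm\<close>)
      finally have "T.fraction s a \<otimes>\<^bsub>T.Loc\<^esub> x = \<one>\<^bsub>T.Loc\<^esub>" .
      then have "\<one>\<^bsub>T.Loc\<^esub> \<in> J" using J.I_l_closed[OF x T.frac_mem[OF mem(2,1)]] by simp
      then show False using J(2) J.one_imp_carrier by blast
    qed
    then show "x \<in> ?M" using a by (auto simp: T.extension_def)
  qed
  show ?thesis
  proof
    assume "maximalideal N T.Loc"
    then interpret N: maximalideal N T.Loc .
    have "?M \<subseteq> carrier T.Loc" using ideal.Icarr[OF M] by (rule subsetI)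
    from N.I_maximal[OF M le[OF N.is_ideal N.I_notcarr[symmetric]] this]
    show "N = ?M" using proper by simp
  next
    assume "N = ?M"
    moreover have "maximalideal ?M T.Loc"
    proof (rule maximalidealI[OF M proper[symmetric]])
      fix J assume "ideal J T.Loc" "?M \<subseteq> J"
      then show "J = ?M \<or> J = carrier T.Loc" using le[of J] by (metis subset_antisym)
    qed
    ultimately show "maximalideal N T.Loc" by simp
  qed
qed

section \<open>Depth is at most dimension\<close>

text \<open>
  An ideal that is maximal among those avoiding \<open>T\<close> is prime: if neither \<open>a\<close> nor \<open>b\<close> lies in it,
  then adding either one makes it meet \<open>T\<close>, and the product of the two meeting points would lie in
  the ideal as soon as \<open>a b\<close> did.
\<close>

lemma (in cring) exists_prime_disjoint:
  assumes I: "ideal I R" and T: "mult_closed_subset R T" and disj: "I \<inter> T = {}"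
  obtains P where "primeideal P R" "I \<subseteq> P" "P \<inter> T = {}"
proof -
  interpret T: mult_closed_subset R T by fact
  define A where "A = {J. ideal J R \<and> I \<subseteq> J \<and> J \<inter> T = {}}"
  have "\<exists>P\<in>A. \<forall>J\<in>A. P \<subseteq> J \<longrightarrow> J = P"
  proof (rule subset_Zorn_nonempty)
    show "A \<noteq> {}" using I disj by (auto simp: A_def)
    fix C assume C: "C \<noteq> {}" "subset.chain A C"
    then have CA: "C \<subseteq> A" by (simp add: subset.chain_def)
    have "subset.chain {J. ideal J R} C"
      using C(2) unfolding subset.chain_def A_def by blast
    from chain_Union_is_ideal[OF this] C(1) have "ideal (\<Union>C) R" by simp
    moreover have "I \<subseteq> \<Union>C" using C(1) CA unfolding A_def by blast
    moreover have "\<Union>C \<inter> T = {}" using CA unfolding A_def by blast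
    ultimately show "\<Union>C \<in> A" by (simp add: A_def)
  qed
  then obtain P where PA: "P \<in> A" and maxA: "\<And>J. J \<in> A \<Longrightarrow> P \<subseteq> J \<Longrightarrow> J = P" by blast
  from PA have P: "ideal P R" "I \<subseteq> P" "P \<inter> T = {}" by (simp_all add: A_def)
  have max: "J = P" if "ideal J R" "P \<subseteq> J" "J \<inter> T = {}" for J
    using that P(2) by (intro maxA) (auto simp: A_def)
  interpret P: ideal P R by (rule P(1))
  have meet: "\<exists>p\<in>P. \<exists>r\<in>carrier R. p \<oplus> r \<otimes> a \<in> T" if a: "a \<in> carrier R" "a \<notin> P" for a
  proof -
    let ?J = "P <+>\<^bsub>R\<^esub> PIdl a"
    have J: "ideal ?J R" by (rule add_ideals[OF P(1) cgenideal_ideal[OF a(1)]])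
    have mem: "p \<oplus> r \<otimes> a \<in> ?J" if "p \<in> P" "r \<in> carrier R" for p r
      using that by (auto simp: set_add_def' cgenideal_def)
    have "P \<subseteq> ?J"
    proof
      fix p assume "p \<in> P"
      then show "p \<in> ?J" using mem[of p \<zero>] a(1) P.Icarr by simp
    qed
    moreover have "a \<in> ?J" using mem[of \<zero> \<one>] a(1) P.zero_closed by simp
    ultimately have "?J \<inter> T \<noteq> {}" using max[OF J] a(2) by metis
    then show ?thesis by (auto simp: set_add_def' cgenideal_def)
  qed
  have "primeideal P R"
  proof (rule primeidealI[OF P(1) is_cring])
    show "carrier R \<noteq> P" using P(3) T.one_mem by blast
    fix a b assume ab: "a \<in> carrier R" "b \<in> carrier R" "a \<otimes> b \<in> P"
    show "a \<in> P \<or> b \<in> P"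
    proof (rule ccontr)
      assume "\<not> ?thesis"
      then have nab: "a \<notin> P" "b \<notin> P" by blast+
      obtain p r where pr: "p \<in> P" "r \<in> carrier R" "p \<oplus> r \<otimes> a \<in> T"
        using meet[OF ab(1) nab(1)] by blast
      obtain q s where qs: "q \<in> P" "s \<in> carrier R" "q \<oplus> s \<otimes> b \<in> T"
        using meet[OF ab(2) nab(2)] by blast
      have mem: "p \<in> carrier R" "q \<in> carrier R" using pr(1) qs(1) by (simp_all add: P.Icarr)
      have "(p \<oplus> r \<otimes> a) \<otimes> (q \<oplus> s \<otimes> b)
          = p \<otimes> (q \<oplus> s \<otimes> b) \<oplus> ((r \<otimes> a) \<otimes> q \<oplus> (r \<otimes> a) \<otimes> (s \<otimes> b))"
        using mem ab(1,2) pr(2) qs(2) by (simp add: l_distr r_distr a_ac)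
      also have "(r \<otimes> a) \<otimes> (s \<otimes> b) = (r \<otimes> s) \<otimes> (a \<otimes> b)"
        using ab(1,2) pr(2) qs(2) by (simp add: m_ac)
      also have "p \<otimes> (q \<oplus> s \<otimes> b) \<oplus> ((r \<otimes> a) \<otimes> q \<oplus> (r \<otimes> s) \<otimes> (a \<otimes> b)) \<in> P"
        using mem ab pr(1,2) qs(1,2) by (simp add: P.a_closed P.I_l_closed P.I_r_closed)
      finally show False using P(3) T.mult_mem[OF pr(3) qs(3)] by blast
    qed
  qed
  then show thesis using that P by blast
qed

text \<open>
  A nonzerodivisor modulo \<open>I\<close> lies outside some prime between \<open>I\<close> and \<open>P\<close>. That prime is found as one
  avoiding all products of a power of \<open>x\<close> with an element outside \<open>P\<close>: avoiding the latter factors keeps it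
  inside \<open>P\<close>, and avoiding \<open>x\<close> makes the inclusion strict.
\<close>

lemma (in cring) exists_smaller_prime:
  assumes P: "primeideal P R" and I: "ideal I R" "I \<subseteq> P" and x: "x \<in> P"
    and nzd: "\<And>a. \<lbrakk>a \<in> carrier R; x \<otimes> a \<in> I\<rbrakk> \<Longrightarrow> a \<in> I"
  obtains Q where "primeideal Q R" "I \<subseteq> Q" "Q \<subset> P"
proof -
  interpret P: primeideal P R by fact
  have xc: "x \<in> carrier R" using x P.Icarr by blast
  define T where "T = {x [^] n \<otimes> s |(n::nat) s. s \<in> carrier R - P}"
  have one: "\<one> \<in> carrier R - P" using P.I_notcarr P.one_imp_carrier by blast
  have T: "mult_closed_subset R T"
  proof
    show "T \<subseteq> carrier R" using xc by (auto simp: T_def)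
    have "\<one> = x [^] (0::nat) \<otimes> \<one>" by simp
    then show "\<one> \<in> T" using one unfolding T_def by blast
    fix y z assume "y \<in> T" "z \<in> T"
    then obtain m n s t where *: "y = x [^] (m::nat) \<otimes> s" "z = x [^] (n::nat) \<otimes> t"
      "s \<in> carrier R - P" "t \<in> carrier R - P" unfolding T_def by blast
    have "y \<otimes> z = (x [^] m \<otimes> x [^] n) \<otimes> (s \<otimes> t)"
      using * xc by (simp add: m_ac)
    also have "\<dots> = x [^] (m + n) \<otimes> (s \<otimes> t)" using xc by (simp add: nat_pow_mult)
    finally have "y \<otimes> z = x [^] (m + n) \<otimes> (s \<otimes> t)" .
    moreover have "s \<otimes> t \<in> carrier R - P" using *(3,4) P.I_prime[of s t] by blast
    ultimately show "y \<otimes> z \<in> T" unfolding T_def by blast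
  qed
  have nzd_pow: "s \<in> I" if "s \<in> carrier R" "x [^] n \<otimes> s \<in> I" for n :: nat and s
    using that
  proof (induction n)
    case (Suc n)
    have "x \<otimes> (x [^] n \<otimes> s) \<in> I" using Suc.prems xc by (simp add: m_ac)
    moreover have "x [^] n \<otimes> s \<in> carrier R" using Suc.prems(1) xc by simp
    ultimately have "x [^] n \<otimes> s \<in> I" using nzd by blast
    then show ?case by (rule Suc.IH[OF Suc.prems(1)])
  qed simp
  have "I \<inter> T = {}"
  proof (rule ccontr)
    assume "I \<inter> T \<noteq> {}"
    then obtain n s where "x [^] (n::nat) \<otimes> s \<in> I" "s \<in> carrier R" "s \<notin> P"
      unfolding T_def by blast
    then show False using nzd_pow[of s n] I(2) by blast
  qed
  from exists_prime_disjoint[OF I(1) T this]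
  obtain Q where Q: "primeideal Q R" "I \<subseteq> Q" "Q \<inter> T = {}" .
  have "Q \<subseteq> carrier R" using ideal.Icarr[OF primeideal.axioms(1)[OF Q(1)]] by (rule subsetI)
  moreover have "s \<in> T" if s: "s \<in> carrier R - P" for s
  proof -
    have "s = x [^] (0::nat) \<otimes> s" using s by simp
    then show ?thesis using s unfolding T_def by blast
  qed
  moreover have "x \<in> T"
  proof -
    have "x = x [^] (1::nat) \<otimes> \<one>" using xc by simp
    then show ?thesis using one unfolding T_def by blast
  qed
  ultimately have "Q \<subset> P" using Q(3) x by blast
  then show thesis using that Q by blast
qed

text \<open>
  The chain is built downwards from a prime over the whole sequence; dropping the last remaining
  element of the sequence makes room for one strictly smaller prime.
\<close>

lemma (in cring) prime_chain_of_regular_sequence: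
  assumes xs: "regular_sequence R xs"
  shows "\<exists>Ps. prime_chain R Ps \<and> length Ps = Suc (length xs)"
proof -
  let ?I = "\<lambda>i. genideal R (set (take i xs))"
  have sub: "set xs \<subseteq> carrier R" and proper: "genideal R (set xs) \<noteq> carrier R"
    using xs by (auto simp: regular_sequence_def)
  have sub': "set (take i xs) \<subseteq> carrier R" for i using sub by (meson order_trans set_take_subset)
  note I = genideal_ideal[OF sub']
  have "\<exists>Ps. prime_chain R Ps \<and> length Ps = Suc i \<and> ?I (length xs - i) \<subseteq> hd Ps"
    if "i \<le> length xs" for i
    using that
  proof (induction i)
    case 0
    have "\<one> \<notin> genideal R (set xs)"
      using proper ideal.one_imp_carrier[OF genideal_ideal[OF sub]] by blast
    then have "genideal R (set xs) \<inter> {\<one>} = {}" by simp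
    moreover have "mult_closed_subset R {\<one>}" by unfold_locales auto
    ultimately obtain P where "primeideal P R" "genideal R (set xs) \<subseteq> P"
      using exists_prime_disjoint[OF genideal_ideal[OF sub]] by metis
    then have "prime_chain R [P] \<and> length [P] = Suc 0 \<and> ?I (length xs - 0) \<subseteq> hd [P]"
      by (auto simp: prime_chain_def)
    then show ?case by blast
  next
    case (Suc i)
    then obtain Ps where Ps: "prime_chain R Ps" "length Ps = Suc i" "?I (length xs - i) \<subseteq> hd Ps"
      by auto
    define j where "j = length xs - Suc i"
    have j: "j < length xs" "length xs - i = Suc j" using Suc.prems by (auto simp: j_def)
    obtain P Qs where PQ: "Ps = P # Qs" using Ps(2) by (cases Ps) auto
    have P: "primeideal P R" using Ps(1) PQ by (auto simp: prime_chain_def)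
    have gen: "?I (Suc j) \<subseteq> P" using Ps(3) PQ j by simp
    have "set (take j xs) \<subseteq> set (take (Suc j) xs)" by (simp add: set_take_subset_set_take)
    then have "?I j \<subseteq> P" using gen subset_Idl_subset[OF sub'] by blast
    moreover have "xs ! j \<in> P"
      using gen genideal_self[OF sub', of "Suc j"] j(1) by (auto simp: take_Suc_conv_app_nth)
    ultimately obtain Q where Q: "primeideal Q R" "?I j \<subseteq> Q" "Q \<subset> P"
      using exists_smaller_prime[OF P I] xs j(1) unfolding regular_sequence_def by metis
    have "prime_chain R (Q # Ps)" using Ps(1) Q PQ by (fastforce simp: prime_chain_def)
    then show ?case using Q Ps(2) unfolding j_def by (intro exI[of _ "Q # Ps"]) auto
  qed
  from this[of "length xs"] show ?thesis by auto
qed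

lemma (in cring) depth_le_krull_dim: "depth R I \<le> krull_dim R"
  unfolding depth_def
proof (rule SUP_least, clarify)
  fix xs assume "regular_sequence R xs"
  then obtain Ps where "prime_chain R Ps" "length Ps = Suc (length xs)"
    using prime_chain_of_regular_sequence by blast
  then show "enat (length xs) \<le> krull_dim R"
    unfolding krull_dim_def by (intro SUP_upper2[of Ps]) auto
qed

text \<open>
  Since depth never exceeds dimension, an upper bound \<open>n\<close> for the dimension and regular sequences of
  length \<open>n\<close> at all maximal ideals force equality everywhere.
\<close>

lemma (in cring) cohen_macaulay_ringI:
  assumes noeth: "noetherian_ring R"
    and dim: "krull_dim R \<le> enat n"
    and reg: "\<And>M. maximalideal M R \<Longrightarrow> \<exists>xs. regular_sequence R xs \<and> set xs \<subseteq> M \<and> length xs = n"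
  shows "cohen_macaulay_ring R"
  unfolding cohen_macaulay_ring_def
proof (intro conjI allI impI is_cring noeth)
  fix M assume M: "maximalideal M R"
  interpret M: primeideal M R by (rule maximalideal_prime[OF M])
  interpret T: mult_closed_subset R "carrier R - M" by (rule M.mult_closed_complement)
  have "krull_dim T.Loc \<le> enat n"
    unfolding krull_dim_def
  proof (rule SUP_least, clarify)
    fix Ps assume "prime_chain T.Loc Ps"
    then have "prime_chain R (map T.contraction Ps)" by (rule T.prime_chain_contraction)
    then have "enat (length (map T.contraction Ps) - 1) \<le> krull_dim R"
      unfolding krull_dim_def by (intro SUP_upper2[of "map T.contraction Ps"]) auto
    from order_trans[OF this dim] show "enat (length Ps - 1) \<le> enat n" by simp
  qed
  moreover have "enat n \<le> depth T.Loc (T.extension M)"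
  proof -
    obtain xs where xs: "regular_sequence R xs" "set xs \<subseteq> M" "length xs = n"
      using reg[OF M] by blast
    let ?ys = "map (\<lambda>a. T.fraction a \<one>) xs"
    have "regular_sequence T.Loc ?ys"
      by (rule T.regular_sequence_frac[OF xs(1) M.is_ideal xs(2)]) auto
    moreover have "set ?ys \<subseteq> T.extension M" using xs(2) T.one_mem by (auto simp: T.extension_def)
    ultimately show ?thesis
      unfolding depth_def using xs(3) by (intro SUP_upper2[of ?ys]) auto
  qed
  moreover have "depth T.Loc (T.extension M) \<le> krull_dim T.Loc" by (rule T.Loc.depth_le_krull_dim)
  ultimately have "depth T.Loc (T.extension M) = krull_dim T.Loc" by (metis order.trans order.antisym)
  then show "cohen_macaulay_local_ring T.Loc"
    unfolding cohen_macaulay_local_ring_def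
    using T.cring_Loc T.noetherian_Loc[OF noeth] M.maximalideal_localization_iff by blast
qed

section \<open>Linear dependence\<close>

text \<open>
  Gaussian elimination: an equation with a nonzero coefficient at the unknown \<open>j\<close> is solved for \<open>j\<close>,
  which removes one equation and one unknown. Indexed families, rather than sets of vectors, are used
  because the vectors to which this is applied may coincide.
\<close>

lemma homogeneous_system_has_solution:
  fixes a :: "'i \<Rightarrow> 'v \<Rightarrow> 'k::field"
  assumes "finite K" "finite I" "card K < card I"
  shows "\<exists>c. (\<exists>i\<in>I. c i \<noteq> 0) \<and> (\<forall>v\<in>K. (\<Sum>i\<in>I. c i * a i v) = 0)"
  using assms
proof (induction K arbitrary: I a rule: finite_induct)
  case empty
  then have "I \<noteq> {}" by auto
  then show ?case by (intro exI[of _ "\<lambda>_. 1"]) auto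
next
  case (insert k K)
  show ?case
  proof (cases "\<forall>i\<in>I. a i k = 0")
    case True
    obtain c where "\<exists>i\<in>I. c i \<noteq> 0" "\<forall>v\<in>K. (\<Sum>i\<in>I. c i * a i v) = 0"
      using insert.IH[of I a] insert.prems insert.hyps by auto
    with True show ?thesis by (intro exI[of _ c]) auto
  next
    case False
    then obtain j where j: "j \<in> I" "a j k \<noteq> 0" by blast
    define a' where "a' i v = a i v - a i k / a j k * a j v" for i v
    have "card K < card (I - {j})" using insert.prems insert.hyps j by simp
    then obtain c where c: "\<exists>i\<in>I - {j}. c i \<noteq> 0" "\<forall>v\<in>K. (\<Sum>i\<in>I - {j}. c i * a' i v) = 0"
      using insert.IH[of "I - {j}" a'] insert.prems by auto
    define c' where "c' = c(j := - (\<Sum>i\<in>I - {j}. c i * a i k / a j k))"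
    have "(\<Sum>i\<in>I. c' i * a i v) = (\<Sum>i\<in>I - {j}. c i * a' i v)" for v
    proof -
      have "(\<Sum>i\<in>I. c' i * a i v) = c' j * a j v + (\<Sum>i\<in>I - {j}. c' i * a i v)"
        using j insert.prems by (simp add: sum.remove)
      also have "(\<Sum>i\<in>I - {j}. c' i * a i v) = (\<Sum>i\<in>I - {j}. c i * a i v)"
        by (rule sum.cong) (auto simp: c'_def)
      also have "c' j * a j v = - (\<Sum>i\<in>I - {j}. c i * a i k / a j k * a j v)"
        by (simp add: c'_def sum_distrib_right)
      finally show ?thesis
        by (simp add: a'_def algebra_simps sum_subtractf)
    qed
    moreover have "a' i k = 0" for i using j by (simp add: a'_def)
    ultimately have "\<forall>v\<in>insert k K. (\<Sum>i\<in>I. c' i * a i v) = 0" using c(2) by auto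
    moreover have "\<exists>i\<in>I. c' i \<noteq> 0" using c(1) by (auto simp: c'_def)
    ultimately show ?thesis by blast
  qed
qed

section \<open>Finitely supported functions\<close>

abbreviation cst :: "'k::zero \<Rightarrow> ('a::zero \<Rightarrow>\<^sub>0 'k)" where "cst \<equiv> Poly_Mapping.single 0"
abbreviation mon :: "'a \<Rightarrow> ('a \<Rightarrow>\<^sub>0 'k::zero_neq_one)" where "mon v \<equiv> Poly_Mapping.single v 1"

lemma sum_single_keys:
  "(\<Sum>v\<in>Poly_Mapping.keys p. Poly_Mapping.single v (Poly_Mapping.lookup p v)) = p"
  by (rule poly_mapping_eqI)
    (simp add: lookup_sum lookup_single when_def not_in_keys_iff_lookup_eq_zero)

lemma keys_subset_induct [consumes 1, case_names zero add single]:
  fixes p :: "'a \<Rightarrow>\<^sub>0 'b::comm_monoid_add"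
  assumes "Poly_Mapping.keys p \<subseteq> A"
    and "P 0" and "\<And>p q. P p \<Longrightarrow> P q \<Longrightarrow> P (p + q)"
    and "\<And>v c. v \<in> A \<Longrightarrow> P (Poly_Mapping.single v c)"
  shows "P p"
proof -
  have "P (\<Sum>v\<in>B. Poly_Mapping.single v (Poly_Mapping.lookup p v))" if "finite B" "B \<subseteq> A" for B
    using that by (induction B) (auto intro: assms)
  from this[of "Poly_Mapping.keys p"] assms(1) show ?thesis by (simp add: sum_single_keys)
qed

lemma lookup_single_mult:
  fixes p :: "'a::cancel_comm_monoid_add \<Rightarrow>\<^sub>0 'k::semiring_0"
  shows "Poly_Mapping.lookup (Poly_Mapping.single v c * p) (v + w) = c * Poly_Mapping.lookup p w"
proof -
  have "Poly_Mapping.lookup (Poly_Mapping.single v c * p) (v + w) =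
        Poly_Mapping.lookup (\<Sum>u\<in>Poly_Mapping.keys p.
           Poly_Mapping.single (v + u) (c * Poly_Mapping.lookup p u)) (v + w)"
    by (subst (1) sum_single_keys[of p, symmetric]) (simp add: sum_distrib_left mult_single)
  also have "\<dots> = c * Poly_Mapping.lookup p w"
    by (simp add: lookup_sum lookup_single when_def not_in_keys_iff_lookup_eq_zero)
  finally show ?thesis .
qed

lemma lookup_cst_mult:
  fixes p :: "'a::cancel_comm_monoid_add \<Rightarrow>\<^sub>0 'k::semiring_0"
  shows "Poly_Mapping.lookup (cst c * p) w = c * Poly_Mapping.lookup p w"
  using lookup_single_mult[of 0 c p w] by simp

lemma single_eq_cst_mult:
  "Poly_Mapping.single v c = cst c * (mon v :: 'a::monoid_add \<Rightarrow>\<^sub>0 'k::semiring_1)"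
  by (simp add: mult_single)

lemma cst_mult_cst: "cst a * cst b = (cst (a * b) :: 'a::monoid_add \<Rightarrow>\<^sub>0 'k::semiring_0)"
  by (simp add: mult_single)

lemma keys_uminus: "Poly_Mapping.keys (- p) = Poly_Mapping.keys (p :: 'a \<Rightarrow>\<^sub>0 'k::ab_group_add)"
  by (auto simp: in_keys_iff)

lemma keys_minus_subset:
  "Poly_Mapping.keys (p - q) \<subseteq> Poly_Mapping.keys p \<union> Poly_Mapping.keys (q :: 'a \<Rightarrow>\<^sub>0 'k::ab_group_add)"
  by (auto simp: in_keys_iff lookup_minus)

lemma keys_sum_subset:
  assumes "\<And>i. i \<in> I \<Longrightarrow> Poly_Mapping.keys (p i) \<subseteq> A"
  shows "Poly_Mapping.keys (\<Sum>i\<in>I. p i) \<subseteq> A"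
  using assms
proof (induction I rule: infinite_finite_induct)
  case (insert i I)
  then show ?case using keys_add[of "p i" "sum p I"] by (simp add: subset_iff) blast
qed auto

lemma keys_single_mult_subset:
  fixes p :: "'a::monoid_add \<Rightarrow>\<^sub>0 'k::semiring_0"
  assumes "x \<in> Poly_Mapping.keys (Poly_Mapping.single v c * p)"
  obtains u where "u \<in> Poly_Mapping.keys p" "x = v + u"
  using subsetD[OF keys_mult assms] by (auto split: if_splits)

lemma keys_cst_mult_subset:
  fixes p :: "'a::monoid_add \<Rightarrow>\<^sub>0 'k::semiring_0"
  shows "Poly_Mapping.keys (cst c * p) \<subseteq> Poly_Mapping.keys p"
  by (auto elim: keys_single_mult_subset)

lemma exists_linear_dependence:
  fixes p :: "'i \<Rightarrow> ('a::cancel_comm_monoid_add \<Rightarrow>\<^sub>0 'k::field)"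
  assumes "finite I" "finite A" "card A < card I" "\<And>i. i \<in> I \<Longrightarrow> Poly_Mapping.keys (p i) \<subseteq> A"
  shows "\<exists>c. (\<exists>i\<in>I. c i \<noteq> 0) \<and> (\<Sum>i\<in>I. cst (c i) * p i) = 0"
proof -
  obtain c where c: "\<exists>i\<in>I. c i \<noteq> 0"
    "\<forall>v\<in>A. (\<Sum>i\<in>I. c i * Poly_Mapping.lookup (p i) v) = 0"
    using homogeneous_system_has_solution[OF assms(2,1,3), of "\<lambda>i. Poly_Mapping.lookup (p i)"] by auto
  have "Poly_Mapping.lookup (\<Sum>i\<in>I. cst (c i) * p i) v = 0" for v
  proof (cases "v \<in> A")
    case True
    with c(2) show ?thesis by (simp add: lookup_sum lookup_cst_mult)
  next
    case False
    then have "Poly_Mapping.lookup (p i) v = 0" if "i \<in> I" for i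
      using assms(4)[OF that] by (auto simp: in_keys_iff)
    then show ?thesis by (simp add: lookup_sum lookup_cst_mult)
  qed
  then have "(\<Sum>i\<in>I. cst (c i) * p i) = 0" by (simp add: poly_mapping_eqI)
  with c(1) show ?thesis by blast
qed

lemma keys_power_box:
  fixes p :: "(nat \<times> nat) \<Rightarrow>\<^sub>0 'k::comm_semiring_1"
  assumes "Poly_Mapping.keys p \<subseteq> {..D} \<times> {..D}"
  shows "Poly_Mapping.keys (p ^ n) \<subseteq> {..n * D} \<times> {..n * D}"
proof (induction n)
  case (Suc n)
  show ?case
  proof
    fix v assume "v \<in> Poly_Mapping.keys (p ^ Suc n)"
    then obtain x y where "v = x + y" "x \<in> Poly_Mapping.keys p" "y \<in> Poly_Mapping.keys (p ^ n)"
      using keys_mult[of p "p ^ n"] by auto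
    moreover from this have "x \<in> {..D} \<times> {..D}" "y \<in> {..n * D} \<times> {..n * D}"
      using assms Suc.IH by blast+
    ultimately show "v \<in> {..Suc n * D} \<times> {..Suc n * D}" by (auto simp: add_mono)
  qed
qed (auto simp: zero_prod_def)

text \<open>
  There are about \<open>N\<^sup>3\<close> monomials in \<open>x\<close>, \<open>y\<close>, \<open>z\<close> with exponents up to \<open>N\<close>, but their exponents in the
  two variables fill only a square with side proportional to \<open>N\<close>. The relation is written as a
  polynomial in \<open>x\<close> whose coefficients are polynomials in \<open>y\<close> with coefficients in \<open>z\<close>, so that the three
  elements can be removed one at a time.
\<close>

lemma three_elements_algebraically_dependent:
  fixes x y z :: "(nat \<times> nat) \<Rightarrow>\<^sub>0 'k::field"
  obtains N c where "\<exists>i\<le>N. \<exists>j\<le>N. \<exists>l\<le>N. c i j l \<noteq> (0::'k)"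
    and "(\<Sum>i\<le>N. x ^ i * (\<Sum>j\<le>N. y ^ j * (\<Sum>l\<le>N. z ^ l * cst (c i j l)))) = (0::(nat \<times> nat) \<Rightarrow>\<^sub>0 'k)"
proof -
  define E where "E = insert (0, 0) (Poly_Mapping.keys x \<union> Poly_Mapping.keys y \<union> Poly_Mapping.keys z)"
  define D where "D = Suc (Max (fst ` E) + Max (snd ` E))"
  have fin: "finite E" by (simp add: E_def)
  have "E \<subseteq> {..D} \<times> {..D}"
  proof
    fix v assume "v \<in> E"
    then have "fst v \<le> Max (fst ` E)" "snd v \<le> Max (snd ` E)" using fin by simp_all
    then show "v \<in> {..D} \<times> {..D}" by (cases v) (simp add: D_def)
  qed
  then have box: "Poly_Mapping.keys x \<subseteq> {..D} \<times> {..D}" "Poly_Mapping.keys y \<subseteq> {..D} \<times> {..D}"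
      "Poly_Mapping.keys z \<subseteq> {..D} \<times> {..D}" by (auto simp: E_def)
  have D: "D \<ge> 1" by (simp add: D_def)
  \<comment> \<open>The square has at most \<open>(4 D (N + 1))\<^sup>2\<close> points, which is \<open>N (N + 1)\<^sup>2\<close> for this \<open>N\<close>.\<close>
  define N where "N = 16 * D * D"
  define A where "A = {..3 * N * D} \<times> {..3 * N * D}"
  define I where "I = {..N} \<times> {..N} \<times> {..N}"
  have le: "3 * N * D + 1 \<le> 4 * D * (N + 1)" using D by (simp add: algebra_simps)
  have "card A = (3 * N * D + 1) * (3 * N * D + 1)" by (simp add: A_def card_cartesian_product)
  also have "\<dots> \<le> (4 * D * (N + 1)) * (4 * D * (N + 1))" by (rule mult_le_mono[OF le le])
  also have "\<dots> = N * (N + 1) * (N + 1)" by (simp add: N_def algebra_simps)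
  also have "\<dots> < (N + 1) * (N + 1) * (N + 1)" by (intro mult_strict_right_mono) auto
  also have "\<dots> = card I" by (simp add: I_def card_cartesian_product mult.assoc)
  finally have card: "card A < card I" .
  define p where "p = (\<lambda>(i, j, l). x ^ i * (y ^ j * z ^ l))"
  have "Poly_Mapping.keys (p t) \<subseteq> A" if "t \<in> I" for t
  proof
    fix v assume v: "v \<in> Poly_Mapping.keys (p t)"
    obtain i j l where t: "t = (i, j, l)" by (cases t) auto
    obtain a b where ab: "v = a + b" "a \<in> Poly_Mapping.keys (x ^ i)" "b \<in> Poly_Mapping.keys (y ^ j * z ^ l)"
      using v keys_mult[of "x ^ i" "y ^ j * z ^ l"] by (auto simp: p_def t)
    obtain c d where cd: "b = c + d" "c \<in> Poly_Mapping.keys (y ^ j)" "d \<in> Poly_Mapping.keys (z ^ l)"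
      using ab(3) keys_mult[of "y ^ j" "z ^ l"] by auto
    have "a \<in> {..i * D} \<times> {..i * D}" "c \<in> {..j * D} \<times> {..j * D}" "d \<in> {..l * D} \<times> {..l * D}"
      using ab(2) cd(2,3) keys_power_box[OF box(1)] keys_power_box[OF box(2)] keys_power_box[OF box(3)]
      by blast+
    then have le: "fst a \<le> i * D" "snd a \<le> i * D" "fst c \<le> j * D" "snd c \<le> j * D"
      "fst d \<le> l * D" "snd d \<le> l * D" by auto
    have "i * D \<le> N * D" "j * D \<le> N * D" "l * D \<le> N * D"
      using that by (auto simp: I_def t)
    with le have "fst v \<le> 3 * N * D" "snd v \<le> 3 * N * D"
      unfolding ab(1) cd(1) fst_add snd_add by linarith+
    then show "v \<in> A" by (simp add: A_def mem_Times_iff)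
  qed
  moreover have "finite I" "finite A" by (simp_all add: I_def A_def)
  ultimately obtain c where c: "\<exists>t\<in>I. c t \<noteq> 0" "(\<Sum>t\<in>I. cst (c t) * p t) = 0"
    using exists_linear_dependence[of I A p] card by blast
  have "(\<Sum>i\<le>N. x ^ i * (\<Sum>j\<le>N. y ^ j * (\<Sum>l\<le>N. z ^ l * cst (c (i, j, l)))))
      = (\<Sum>t\<in>I. cst (c t) * p t)"
    unfolding I_def p_def by (simp add: sum.cartesian_product' sum_distrib_left mult_ac)
  with c show thesis by (intro that[of N "\<lambda>i j l. c (i, j, l)"]) (auto simp: I_def)
qed

lemma sum_powers_factor_lowest:
  fixes x :: "'r::comm_ring_1"
  assumes "m \<le> N" "\<And>i. i < m \<Longrightarrow> q i = 0"
  shows "(\<Sum>i\<le>N. x ^ i * q i) = x ^ m * (q m + x * (\<Sum>j<N - m. x ^ j * q (Suc (m + j))))"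
proof -
  have "(\<Sum>i\<le>N. x ^ i * q i) = (\<Sum>i\<in>{m..N}. x ^ i * q i)"
    using assms(2) by (intro sum.mono_neutral_right) (auto simp: not_le)
  also have "\<dots> = (\<Sum>i\<le>N - m. x ^ (m + i) * q (m + i))"
    using assms(1) by (intro sum.reindex_bij_witness[of _ "\<lambda>i. m + i" "\<lambda>i. i - m"]) auto
  also have "\<dots> = x ^ m * (\<Sum>i\<le>N - m. x ^ i * q (m + i))"
    by (simp add: sum_distrib_left power_add mult_ac)
  also have "(\<Sum>i\<le>N - m. x ^ i * q (m + i)) = q m + x * (\<Sum>j<N - m. x ^ j * q (Suc (m + j)))"
    by (subst sum.atMost_shift) (simp add: sum_distrib_left mult_ac)
  finally show ?thesis .
qed

section \<open>Semigroup rings and their dimension\<close>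

lemma semigroup_ring_simps [simp]:
  "p \<otimes>\<^bsub>semigroup_ring S\<^esub> q = p * q" "p \<oplus>\<^bsub>semigroup_ring S\<^esub> q = p + q"
  "\<one>\<^bsub>semigroup_ring S\<^esub> = 1" "\<zero>\<^bsub>semigroup_ring S\<^esub> = 0"
  by (simp_all add: semigroup_ring_def)

text \<open>
  Inside \<open>k[x, y]\<close> the carrier of the semigroup ring is a set \<open>polys\<close> on which the ring operations of
  the type \<open>_ \<Rightarrow>\<^sub>0 _\<close> act, so that calculations can use the type class structure.
\<close>

locale plane_monoid =
  fixes S :: "(nat \<times> nat) set"
  assumes zero_mem [simp]: "0 \<in> S"
    and add_mem: "\<lbrakk>v \<in> S; w \<in> S\<rbrakk> \<Longrightarrow> v + w \<in> S"
begin

abbreviation R :: "((nat \<times> nat) \<Rightarrow>\<^sub>0 'k::field) ring" where "R \<equiv> semigroup_ring S"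

definition polys :: "((nat \<times> nat) \<Rightarrow>\<^sub>0 'k::field) set" where "polys = {p. Poly_Mapping.keys p \<subseteq> S}"

lemma carrier_R [simp]: "carrier R = polys"
  by (simp add: polys_def semigroup_ring_def)

lemma polys_0 [simp]: "0 \<in> polys" and polys_1 [simp]: "1 \<in> polys" and polys_cst [simp]: "cst c \<in> polys"
  by (auto simp: polys_def)

lemma polys_single: "v \<in> S \<Longrightarrow> Poly_Mapping.single v c \<in> polys"
  by (auto simp: polys_def)

lemma polys_add [simp]: "\<lbrakk>p \<in> polys; q \<in> polys\<rbrakk> \<Longrightarrow> p + q \<in> polys"
  using keys_add[of p q] by (auto simp: polys_def)

lemma polys_uminus [simp]: "p \<in> polys \<Longrightarrow> - p \<in> polys"
  by (simp add: polys_def keys_uminus)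

lemma polys_diff [simp]: "\<lbrakk>p \<in> polys; q \<in> polys\<rbrakk> \<Longrightarrow> p - q \<in> polys"
  using keys_minus_subset[of p q] by (auto simp: polys_def)

lemma polys_mult [simp]: "\<lbrakk>p \<in> polys; q \<in> polys\<rbrakk> \<Longrightarrow> p * q \<in> polys"
  using keys_mult[of p q] add_mem by (fastforce simp: polys_def)

lemma polys_power [simp]: "p \<in> polys \<Longrightarrow> p ^ n \<in> polys"
  by (induction n) auto

lemma polys_sum: "(\<And>i. i \<in> I \<Longrightarrow> p i \<in> polys) \<Longrightarrow> (\<Sum>i\<in>I. p i) \<in> polys"
  by (simp add: polys_def keys_sum_subset)

lemma cring_semigroup_ring: "cring (R :: ((nat \<times> nat) \<Rightarrow>\<^sub>0 'k::field) ring)"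
proof (rule cringI)
  show "abelian_group (R :: ((nat \<times> nat) \<Rightarrow>\<^sub>0 'k::field) ring)"
  proof (rule abelian_groupI)
    fix x :: "(nat \<times> nat) \<Rightarrow>\<^sub>0 'k" assume "x \<in> carrier R"
    then show "\<exists>y\<in>carrier R. y \<oplus>\<^bsub>R\<^esub> x = \<zero>\<^bsub>R\<^esub>" by (intro bexI[of _ "- x"]) simp_all
  qed (simp_all add: add_ac)
  show "comm_monoid (R :: ((nat \<times> nat) \<Rightarrow>\<^sub>0 'k::field) ring)"
    by (rule comm_monoidI) (simp_all add: mult_ac)
qed (simp add: distrib_right)

lemma ideal_subset: "ideal I R \<Longrightarrow> p \<in> I \<Longrightarrow> p \<in> polys"
  using ideal.Icarr[of I R p] by simp

lemma ideal_zero: "ideal I R \<Longrightarrow> 0 \<in> I"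
  using additive_subgroup.zero_closed[OF ideal.axioms(1), of I R] by simp

lemma ideal_add: "ideal I R \<Longrightarrow> p \<in> I \<Longrightarrow> q \<in> I \<Longrightarrow> p + q \<in> I"
  using additive_subgroup.a_closed[OF ideal.axioms(1), of I R p q] by simp

lemma ideal_mult: "ideal I R \<Longrightarrow> p \<in> I \<Longrightarrow> q \<in> polys \<Longrightarrow> q * p \<in> I"
  using ideal.I_l_closed[of I R p q] by simp

lemma ideal_uminus: "ideal I R \<Longrightarrow> p \<in> I \<Longrightarrow> - p \<in> I"
  using ideal_mult[of I p "- 1"] by simp

lemma ideal_diff: "ideal I R \<Longrightarrow> p \<in> I \<Longrightarrow> q \<in> I \<Longrightarrow> p - q \<in> I"
  using ideal_add[of I p "- q"] ideal_uminus[of I q] by simp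

lemma ideal_sum: "ideal I R \<Longrightarrow> (\<And>i. i \<in> A \<Longrightarrow> p i \<in> I) \<Longrightarrow> (\<Sum>i\<in>A. p i) \<in> I"
  by (induction A rule: infinite_finite_induct) (auto simp: ideal_zero ideal_add)

lemma proper_ideal_cst:
  assumes "ideal I R" "I \<noteq> carrier R" "cst c \<in> I"
  shows "c = 0"
proof (rule ccontr)
  assume "c \<noteq> 0"
  then have inv: "cst (inverse c) * cst c = (1 :: (nat \<times> nat) \<Rightarrow>\<^sub>0 'a)" by (simp add: cst_mult_cst)
  have "1 \<in> I" using ideal_mult[OF assms(1,3), of "cst (inverse c)"] unfolding inv by simp
  then show False using ideal.one_imp_carrier[OF assms(1)] assms(2) by simp
qed

lemma primeideal_cancel:
  assumes P: "primeideal P R" and "x \<in> polys" "x \<notin> P" "y \<in> polys" "x * y \<in> P"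
  shows "y \<in> P"
  using primeideal.I_prime[OF P, of x y] assms(2-) by simp

lemma power_cancel:
  assumes "\<And>y. \<lbrakk>y \<in> polys; x * y \<in> P\<rbrakk> \<Longrightarrow> y \<in> P" "x \<in> polys" "y \<in> polys" "x ^ m * y \<in> P"
  shows "y \<in> P"
  using assms(4)
proof (induction m)
  case (Suc m)
  have "x ^ m * y \<in> polys" using assms(2,3) by simp
  moreover have "x * (x ^ m * y) \<in> P" using Suc.prems by (simp add: mult.assoc)
  ultimately have "x ^ m * y \<in> P" by (rule assms(1))
  then show ?case by (rule Suc.IH)
qed simp

text \<open>
  Dividing the relation by the lowest power of \<open>x\<close> that occurs is possible since \<open>x\<close> can be cancelled
  modulo \<open>P\<close>; what remains is the lowest coefficient plus a multiple of \<open>x \<in> Q\<close>. The predicate \<open>nz\<close> marks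
  coefficients that are formally nonzero: a coefficient is itself the value of a polynomial, which may vanish
  although that polynomial does not.
\<close>

lemma lowest_coefficient_mem:
  assumes Q: "ideal Q R" and PQ: "P \<subseteq> Q" and x: "x \<in> Q"
    and cancel: "\<And>y. \<lbrakk>y \<in> polys; x * y \<in> P\<rbrakk> \<Longrightarrow> y \<in> P"
    and sum: "(\<Sum>i\<le>N. x ^ i * q i) \<in> P"
    and q: "\<And>i. q i \<in> polys" "\<And>i. \<not> nz i \<Longrightarrow> q i = 0" and nz: "\<exists>i\<le>N. nz i"
  shows "\<exists>i\<le>N. nz i \<and> q i \<in> Q"
proof -
  define m where "m = (LEAST i. nz i)"
  obtain i where "i \<le> N" "nz i" using nz by blast
  then have m: "nz m" "m \<le> N" unfolding m_def by (auto intro: LeastI Least_le order_trans)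
  have "q i = 0" if "i < m" for i using q(2) not_less_Least[of i nz] that by (auto simp: m_def)
  note split = sum_powers_factor_lowest[of m N q x, OF m(2) this]
  let ?h = "\<Sum>j<N - m. x ^ j * q (Suc (m + j))"
  have xC: "x \<in> polys" using ideal_subset[OF Q x] .
  have h: "?h \<in> polys" using q(1) xC by (intro polys_sum) auto
  have "q m + x * ?h \<in> P"
    by (rule power_cancel[OF cancel xC, of _ m]) (use sum split h xC q(1) in auto)
  then have "q m + x * ?h \<in> Q" using PQ by blast
  moreover have "?h * x \<in> Q" by (rule ideal_mult[OF Q x h])
  ultimately have "(q m + x * ?h) - ?h * x \<in> Q" by (rule ideal_diff[OF Q])
  then have "q m \<in> Q" by (simp add: mult.commute)
  with m show ?thesis by blast
qed

text \<open>
  Given four primes \<open>P\<^sub>0 \<subset> P\<^sub>1 \<subset> P\<^sub>2 \<subset> P\<^sub>3\<close>, choose \<open>x\<^sub>i \<in> P\<^sub>i\<^sub>+\<^sub>1\<close> outside \<open>P\<^sub>i\<close>. A relation between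
  \<open>x\<^sub>0, x\<^sub>1, x\<^sub>2\<close> lies in \<open>P\<^sub>0\<close>; its lowest coefficient in \<open>x\<^sub>0\<close> lies in \<open>P\<^sub>1\<close>, the lowest coefficient of
  that in \<open>x\<^sub>1\<close> lies in \<open>P\<^sub>2\<close>, and the lowest coefficient of that in \<open>x\<^sub>2\<close> is a nonzero constant in \<open>P\<^sub>3\<close>.
\<close>

lemma prime_chain_length_le_3:
  assumes "prime_chain (R :: ((nat \<times> nat) \<Rightarrow>\<^sub>0 'k::field) ring) Ps"
  shows "length Ps \<le> 3"
proof (rule ccontr)
  assume len: "\<not> length Ps \<le> 3"
  have prime: "primeideal (Ps ! i) R" if "i \<le> 3" for i
    using assms len that by (auto simp: prime_chain_def)
  note I = primeideal.axioms(1)[OF prime]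
  have less: "Ps ! i \<subset> Ps ! Suc i" if "i < 3" for i
    using assms len that sorted_wrt_nth_less[of "(\<subset>)" Ps i "Suc i"] by (simp add: prime_chain_def)
  have "\<exists>x. x \<in> Ps ! Suc i \<and> x \<notin> Ps ! i" if "i < 3" for i using less[OF that] by blast
  then obtain x where x: "\<And>i. i < 3 \<Longrightarrow> x i \<in> Ps ! Suc i" "\<And>i. i < 3 \<Longrightarrow> x i \<notin> Ps ! i" by metis
  have xC: "x i \<in> polys" if "i < 3" for i
    using ideal_subset[OF I x(1)[OF that]] that by simp
  have cancel: "y \<in> Ps ! i" if "i < 3" "y \<in> polys" "x i * y \<in> Ps ! i" for i y
    using primeideal_cancel[OF prime xC x(2)] that by simp
  obtain N c where nz: "\<exists>i\<le>N. \<exists>j\<le>N. \<exists>l\<le>N. c i j l \<noteq> (0::'k)"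
    and rel: "(\<Sum>i\<le>N. x 0 ^ i * (\<Sum>j\<le>N. x 1 ^ j * (\<Sum>l\<le>N. x 2 ^ l * cst (c i j l)))) = 0"
    using three_elements_algebraically_dependent[of "x 0" "x 1" "x 2"] by blast
  let ?r = "\<lambda>i j. \<Sum>l\<le>N. x 2 ^ l * cst (c i j l)"
  let ?q = "\<lambda>i. \<Sum>j\<le>N. x 1 ^ j * ?r i j"
  have rC: "?r i j \<in> polys" for i j using xC by (intro polys_sum) auto
  have qC: "?q i \<in> polys" for i using xC rC by (intro polys_sum) auto
  have step: "\<exists>i\<le>N. nz i \<and> q i \<in> Ps ! Suc m"
    if m: "m < 3" and sum: "(\<Sum>i\<le>N. x m ^ i * q i) \<in> Ps ! m"
      and q: "\<And>i. q i \<in> polys" "\<And>i. \<not> nz i \<Longrightarrow> q i = 0" and nz: "\<exists>i\<le>N. nz i" for m q nz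
  proof (rule lowest_coefficient_mem[OF _ _ x(1)[OF m] cancel[OF m] sum q nz])
    show "ideal (Ps ! Suc m) R" using m by (intro I) simp
    show "Ps ! m \<subseteq> Ps ! Suc m" using less[OF m] by (rule psubset_imp_subset)
  qed
  have "\<exists>i\<le>N. (\<exists>j\<le>N. \<exists>l\<le>N. c i j l \<noteq> 0) \<and> ?q i \<in> Ps ! Suc 0"
  proof (rule step[of 0 ?q])
    show "(\<Sum>i\<le>N. x 0 ^ i * ?q i) \<in> Ps ! 0" unfolding rel by (rule ideal_zero[OF I]) simp
  qed (use qC nz in auto)
  then obtain i where i: "\<exists>j\<le>N. \<exists>l\<le>N. c i j l \<noteq> 0" "?q i \<in> Ps ! Suc 0" by blast
  have "\<exists>j\<le>N. (\<exists>l\<le>N. c i j l \<noteq> 0) \<and> ?r i j \<in> Ps ! Suc (Suc 0)"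
    by (rule step[of "Suc 0" "?r i"]) (use i rC in auto)
  then obtain j where j: "\<exists>l\<le>N. c i j l \<noteq> 0" "?r i j \<in> Ps ! Suc (Suc 0)" by blast
  have "\<exists>l\<le>N. c i j l \<noteq> 0 \<and> cst (c i j l) \<in> Ps ! Suc (Suc (Suc 0))"
    by (rule step[of "Suc (Suc 0)" "\<lambda>l. cst (c i j l)"]) (use j in \<open>auto simp: numeral_2_eq_2\<close>)
  then obtain l where "c i j l \<noteq> 0" "cst (c i j l) \<in> Ps ! 3" by (auto simp: numeral_3_eq_3)
  then show False
    using proper_ideal_cst[OF I primeideal.I_notcarr[OF prime, symmetric], of 3] by simp
qed

lemma krull_dim_le_2: "krull_dim (R :: ((nat \<times> nat) \<Rightarrow>\<^sub>0 'k::field) ring) \<le> enat 2"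
  unfolding krull_dim_def
proof (rule SUP_least, clarify)
  fix Ps :: "((nat \<times> nat) \<Rightarrow>\<^sub>0 'k) set list"
  assume "prime_chain R Ps"
  from prime_chain_length_le_3[OF this] show "enat (length Ps - 1) \<le> enat 2" by simp
qed

lemma maximalideal_inverse:
  assumes M: "maximalideal M (R :: ((nat \<times> nat) \<Rightarrow>\<^sub>0 'k::field) ring)" and x: "x \<in> polys" "x \<notin> M"
  obtains r where "r \<in> polys" "1 - x * r \<in> M"
proof -
  interpret R: cring "R :: ((nat \<times> nat) \<Rightarrow>\<^sub>0 'k) ring" by (rule cring_semigroup_ring)
  note I = maximalideal.axioms(1)[OF M]
  let ?J = "M <+>\<^bsub>R\<^esub> cgenideal R x"
  have J: "ideal ?J R" using x(1) by (intro R.add_ideals I R.cgenideal_ideal) simp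
  have mem: "m + r * x \<in> ?J" if "m \<in> M" "r \<in> polys" for m r
    using that by (auto simp: set_add_def' cgenideal_def)
  have "M \<subseteq> ?J"
  proof
    fix m assume "m \<in> M"
    then show "m \<in> ?J" using mem[of m 0] by simp
  qed
  moreover have "?J \<subseteq> carrier R" using ideal.Icarr[OF J] by (rule subsetI)
  moreover have "x \<in> ?J" using mem[of 0 1] ideal_zero[OF I] by simp
  ultimately have "?J = carrier R"
    using maximalideal.I_maximal[OF M J] x(2) by metis
  then have "1 \<in> ?J" by simp
  then obtain m r where m: "m \<in> M" "r \<in> polys" "1 = m + r * x"
    by (auto simp: set_add_def' cgenideal_def)
  have "1 - x * r = m" unfolding m(3) by (simp add: mult.commute)
  then have "1 - x * r \<in> M" using m(1) by simp
  then show thesis by (rule that[OF m(2)])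
qed

end

section \<open>Dickson's lemma and leading terms\<close>

text \<open>
  Fix one point \<open>(p, q)\<close> of \<open>X\<close>. A point that does not dominate it lies in one of the \<open>p\<close> columns to its left
  or in one of the \<open>q\<close> rows below it, and each of these is dominated by its lowest, respectively leftmost, point.
\<close>

lemma Dickson_nat_prod:
  fixes X :: "(nat \<times> nat) set"
  obtains Y where "finite Y" "Y \<subseteq> X" "\<And>a b. (a, b) \<in> X \<Longrightarrow> \<exists>c d. (c, d) \<in> Y \<and> c \<le> a \<and> d \<le> b"
proof (cases "X = {}")
  case True
  with that[of "{}"] show thesis by simp
next
  case False
  then obtain p q where pq: "(p, q) \<in> X" by auto
  define h where "h a = (LEAST b. (a, b) \<in> X)" for a
  define v where "v b = (LEAST a. (a, b) \<in> X)" for b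
  have h: "(a, h a) \<in> X" "h a \<le> b" if "(a, b) \<in> X" for a b
    unfolding h_def using that by (auto intro: LeastI Least_le)
  have v: "(v b, b) \<in> X" "v b \<le> a" if "(a, b) \<in> X" for a b
    unfolding v_def using that by (auto intro: LeastI Least_le)
  define Y where "Y = insert (p, q) (X \<inter> ((\<lambda>a. (a, h a)) ` {..<p} \<union> (\<lambda>b. (v b, b)) ` {..<q}))"
  show thesis
  proof (rule that)
    show "finite Y" "Y \<subseteq> X" using pq by (auto simp: Y_def)
    fix a b assume ab: "(a, b) \<in> X"
    consider "p \<le> a \<and> q \<le> b" | "a < p" | "b < q" by linarith
    then show "\<exists>c d. (c, d) \<in> Y \<and> c \<le> a \<and> d \<le> b"
    proof cases
      case 1
      then show ?thesis unfolding Y_def by blast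
    next
      case 2
      then have "(a, h a) \<in> Y" using h(1)[OF ab] by (simp add: Y_def)
      then show ?thesis using h(2)[OF ab] by blast
    next
      case 3
      then have "(v b, b) \<in> Y" using v(1)[OF ab] by (simp add: Y_def)
      then show ?thesis using v(2)[OF ab] by blast
    qed
  qed
qed

text \<open>A well-founded monomial order, needed to make leading exponents additive and descent terminate.\<close>

definition lex_order :: "((nat \<times> nat) \<times> (nat \<times> nat)) set" where
  "lex_order = less_than <*lex*> less_than"

lemma lex_iff: "((a, b), (c, d)) \<in> lex_order \<longleftrightarrow> a < c \<or> a = c \<and> b < d"
  by (auto simp: lex_order_def)

lemma wf_lex: "wf lex_order"
  by (auto simp: lex_order_def)

lemma lex_trans: "(u, v) \<in> lex_order \<Longrightarrow> (v, w) \<in> lex_order \<Longrightarrow> (u, w) \<in> lex_order"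
  by (cases u; cases v; cases w) (auto simp: lex_iff)

lemma lex_total: "u = v \<or> (u, v) \<in> lex_order \<or> (v, u) \<in> lex_order"
  by (cases u; cases v) (auto simp: lex_iff)

lemma lex_add: "(u, v) \<in> lex_order \<Longrightarrow> (w + u, w + v) \<in> lex_order"
  by (cases u; cases v; cases w) (auto simp: lex_iff)

definition is_lead :: "((nat \<times> nat) \<Rightarrow>\<^sub>0 'k::zero) \<Rightarrow> nat \<times> nat \<Rightarrow> bool" where
  "is_lead p v \<longleftrightarrow> v \<in> Poly_Mapping.keys p \<and> (\<forall>u\<in>Poly_Mapping.keys p. u = v \<or> (u, v) \<in> lex_order)"

lemma lead_exists:
  assumes "p \<noteq> 0" obtains v where "is_lead p v"
proof -
  have "\<exists>v\<in>A. \<forall>u\<in>A. u = v \<or> (u, v) \<in> lex_order" if "finite A" "A \<noteq> {}" for A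
    using that
  proof (induction A rule: finite_ne_induct)
    case (insert a A)
    then obtain v where v: "v \<in> A" "\<forall>u\<in>A. u = v \<or> (u, v) \<in> lex_order" by blast
    show ?case
    proof (cases "(v, a) \<in> lex_order")
      case True
      then have "u = a \<or> (u, a) \<in> lex_order" if "u \<in> insert a A" for u
        using v(2) that lex_trans[of u v a] by auto
      then show ?thesis by blast
    next
      case False
      then have "\<forall>u\<in>insert a A. u = v \<or> (u, v) \<in> lex_order" using v(2) lex_total[of v a] by blast
      then show ?thesis using v(1) by blast
    qed
  qed simp
  from this[of "Poly_Mapping.keys p"] show thesis
    using assms that by (auto simp: is_lead_def)
qed

text \<open>One step of reducing \<open>p\<close> by \<open>g\<close>; the cancelled leading term makes the remainder smaller.\<close>

lemma keys_cancel_lead: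
  fixes p g :: "(nat \<times> nat) \<Rightarrow>\<^sub>0 'k::field"
  assumes p: "is_lead p (w + y)" and g: "is_lead g y"
  defines "c \<equiv> Poly_Mapping.lookup p (w + y) / Poly_Mapping.lookup g y"
  assumes u: "u \<in> Poly_Mapping.keys (p - Poly_Mapping.single w c * g)"
  shows "(u, w + y) \<in> lex_order"
proof -
  have "Poly_Mapping.lookup g y \<noteq> 0" using g by (simp add: is_lead_def in_keys_iff)
  then have "Poly_Mapping.lookup (p - Poly_Mapping.single w c * g) (w + y) = 0"
    by (simp add: lookup_minus lookup_single_mult c_def)
  then have "u \<noteq> w + y" using u by (auto simp: in_keys_iff)
  moreover have "u = w + y \<or> (u, w + y) \<in> lex_order"
  proof (cases "u \<in> Poly_Mapping.keys p")
    case True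
    then show ?thesis using p by (simp add: is_lead_def)
  next
    case False
    then have "u \<in> Poly_Mapping.keys (Poly_Mapping.single w c * g)"
      using subsetD[OF keys_minus_subset u] by blast
    then obtain t where "t \<in> Poly_Mapping.keys g" "u = w + t" by (rule keys_single_mult_subset)
    then show ?thesis using g lex_add[of t y w] by (auto simp: is_lead_def)
  qed
  ultimately show ?thesis by blast
qed

section \<open>Plane monoids with two extremal directions\<close>

definition nmul :: "nat \<Rightarrow> nat \<times> nat \<Rightarrow> nat \<times> nat" where
  "nmul n v = (n * fst v, n * snd v)"

lemma nmul_0 [simp]: "nmul 0 v = 0" and nmul_1: "nmul (Suc 0) v = v"
  by (simp_all add: nmul_def zero_prod_def)

lemma nmul_add: "nmul (m + n) v = nmul m v + nmul n v"
  by (simp add: nmul_def plus_prod_def algebra_simps)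

lemma mon_power: "(mon e :: (nat \<times> nat) \<Rightarrow>\<^sub>0 'k::comm_semiring_1) ^ n = mon (nmul n e)"
proof (induction n)
  case (Suc n)
  have "nmul (Suc n) e = e + nmul n e" using nmul_add[of "Suc 0" n e] by (simp add: nmul_1)
  then show ?case using Suc by (simp add: mult_single)
qed simp

definition coord_sum :: "nat \<times> nat \<Rightarrow> nat" where "coord_sum v = fst v + snd v"

lemma coord_sum_add [simp]: "coord_sum (v + w) = coord_sum v + coord_sum w"
  by (simp add: coord_sum_def)

lemma coord_sum_nmul [simp]: "coord_sum (nmul n v) = n * coord_sum v"
  by (simp add: coord_sum_def nmul_def algebra_simps)

lemma coord_sum_pos: "v \<noteq> 0 \<Longrightarrow> coord_sum v > 0"
  by (cases v) (auto simp: coord_sum_def zero_prod_def)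

text \<open>
  The condition \<open>parallelogram\<close> concerns the lattice point \<open>a - x e\<^sub>1 = c - y e\<^sub>2\<close>, which reaches \<open>S\<close> both along
  \<open>e\<^sub>1\<close> and along \<open>e\<^sub>2\<close>. It is stated without subtraction since that point may have negative
  coordinates before it is known to lie in \<open>S\<close>.
\<close>

locale cm_plane_monoid = plane_monoid +
  fixes e1 e2 :: "nat \<times> nat" and B :: "(nat \<times> nat) set"
  assumes e1_mem: "e1 \<in> S" and e2_mem: "e2 \<in> S"
    and e1_nz: "e1 \<noteq> 0" and e2_nz: "e2 \<noteq> 0"
    and finite_B: "finite B" and B_subset: "B \<subseteq> S"
    and decompose: "v \<in> S \<Longrightarrow> \<exists>s\<in>B. \<exists>x y. v = s + nmul x e1 + nmul y e2"
    and parallelogram: "\<lbrakk>a \<in> S; c \<in> S; a + nmul y e2 = c + nmul x e1\<rbrakk> \<Longrightarrow> \<exists>d\<in>S. a = d + nmul x e1"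
begin

lemma nmul_mem: "v \<in> S \<Longrightarrow> nmul n v \<in> S"
proof (induction n)
  case (Suc n)
  then show ?case using nmul_add[of "Suc 0" n v] by (simp add: nmul_1 add_mem)
qed simp

text \<open>
  On each translate \<open>s + \<nat> e\<^sub>1 + \<nat> e\<^sub>2\<close> this is Dickson's lemma, and finitely many translates cover \<open>S\<close>.
\<close>

lemma finitely_many_minimal:
  assumes "X \<subseteq> S"
  obtains Y where "finite Y" "Y \<subseteq> X" "\<And>v. v \<in> X \<Longrightarrow> \<exists>y\<in>Y. \<exists>w\<in>S. v = w + y"
proof -
  let ?v = "\<lambda>s (x, y). s + nmul x e1 + nmul y e2"
  have "\<exists>Y. finite Y \<and> Y \<subseteq> {t. ?v s t \<in> X} \<and>
      (\<forall>a b. ?v s (a, b) \<in> X \<longrightarrow> (\<exists>c d. (c, d) \<in> Y \<and> c \<le> a \<and> d \<le> b))" for s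
    by (rule Dickson_nat_prod[of "{t. ?v s t \<in> X}"]) auto
  then obtain Y where Ys: "\<And>s. finite (Y s) \<and> Y s \<subseteq> {t. ?v s t \<in> X} \<and>
      (\<forall>a b. ?v s (a, b) \<in> X \<longrightarrow> (\<exists>c d. (c, d) \<in> Y s \<and> c \<le> a \<and> d \<le> b))"
    by metis
  then have Y: "finite (Y s)" "t \<in> Y s \<Longrightarrow> ?v s t \<in> X" for s t by blast+
  have dom: "\<exists>c d. (c, d) \<in> Y s \<and> c \<le> a \<and> d \<le> b" if "?v s (a, b) \<in> X" for s a b
    using Ys[of s] that by blast
  show thesis
  proof (rule that[of "\<Union>s\<in>B. ?v s ` Y s"])
    show "finite (\<Union>s\<in>B. ?v s ` Y s)" using finite_B Y(1) by blast
    show "(\<Union>s\<in>B. ?v s ` Y s) \<subseteq> X" using Y(2) by blast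
    fix v assume v: "v \<in> X"
    then obtain s a b where s: "s \<in> B" "v = s + nmul a e1 + nmul b e2"
      using decompose assms by blast
    then obtain c d where cd: "(c, d) \<in> Y s" "c \<le> a" "d \<le> b" using dom[of s a b] v by auto
    have "nmul a e1 = nmul (a - c) e1 + nmul c e1" "nmul b e2 = nmul (b - d) e2 + nmul d e2"
      using cd by (simp_all add: nmul_add[symmetric])
    then have "v = (nmul (a - c) e1 + nmul (b - d) e2) + ?v s (c, d)"
      using s by (simp add: ac_simps)
    moreover have "nmul (a - c) e1 + nmul (b - d) e2 \<in> S"
      using e1_mem e2_mem by (intro add_mem nmul_mem)
    ultimately show "\<exists>y\<in>\<Union>s\<in>B. ?v s ` Y s. \<exists>w\<in>S. v = w + y" using s(1) cd(1) by blast
  qed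
qed

text \<open>
  Choose elements of the ideal whose leading exponents generate all of its leading exponents under
  translation by \<open>S\<close>. Reducing an element of the ideal by them strictly lowers its leading exponent and stays
  in the ideal, so well-founded descent ends at \<open>0\<close>.
\<close>

lemma noetherian_semigroup_ring: "noetherian_ring (R :: ((nat \<times> nat) \<Rightarrow>\<^sub>0 'k::field) ring)"
proof -
  interpret R: cring "R :: ((nat \<times> nat) \<Rightarrow>\<^sub>0 'k) ring" by (rule cring_semigroup_ring)
  show ?thesis
  proof (rule R.noetherian_ringI)
    fix I :: "((nat \<times> nat) \<Rightarrow>\<^sub>0 'k) set" assume I: "ideal I R"
    have IC: "p \<in> I \<Longrightarrow> Poly_Mapping.keys p \<subseteq> S" for p using ideal_subset[OF I] by (simp add: polys_def)
    define L where "L = {v. \<exists>p\<in>I. is_lead p v}"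
    have "L \<subseteq> S" using IC by (force simp: L_def is_lead_def)
    from finitely_many_minimal[OF this]
    obtain Y where Y: "finite Y" "Y \<subseteq> L" "\<And>v. v \<in> L \<Longrightarrow> \<exists>y\<in>Y. \<exists>w\<in>S. v = w + y"
      by blast
    have "\<exists>p. p \<in> I \<and> is_lead p y" if "y \<in> Y" for y using Y(2) that by (auto simp: L_def)
    then obtain g where g: "\<And>y. y \<in> Y \<Longrightarrow> g y \<in> I" "\<And>y. y \<in> Y \<Longrightarrow> is_lead (g y) y" by metis
    let ?G = "genideal R (g ` Y)"
    have GI: "g ` Y \<subseteq> I" using g(1) by blast
    have sub: "g ` Y \<subseteq> carrier R" using g(1) ideal_subset[OF I] by auto
    note G = R.genideal_ideal[OF sub]
    have gG: "g y \<in> ?G" if "y \<in> Y" for y using R.genideal_self[OF sub] that by blast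
    have lead: "is_lead p v \<Longrightarrow> p \<in> I \<Longrightarrow> p \<in> ?G" for p v
    proof (induction v arbitrary: p rule: wf_induct_rule[OF wf_lex])
      case (1 v)
      then have "v \<in> L" by (auto simp: L_def)
      then obtain y w where y: "y \<in> Y" "w \<in> S" "v = w + y" using Y(3) by blast
      let ?m = "Poly_Mapping.single w (Poly_Mapping.lookup p (w + y) / Poly_Mapping.lookup (g y) y)"
      let ?q = "p - ?m * g y"
      have mC: "?m \<in> polys" by (rule polys_single[OF y(2)])
      have qI: "?q \<in> I" by (rule ideal_diff[OF I 1(3) ideal_mult[OF I g(1)[OF y(1)] mC]])
      have less: "(u, v) \<in> lex_order" if "u \<in> Poly_Mapping.keys ?q" for u
        using keys_cancel_lead[OF _ g(2)[OF y(1)] that] 1(2) y(3) by simp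
      have "?q \<in> ?G"
      proof (cases "?q = 0")
        case True
        then show ?thesis using ideal_zero[OF G] by simp
      next
        case False
        then obtain u where u: "is_lead ?q u" by (rule lead_exists)
        then have "(u, v) \<in> lex_order" using less by (simp add: is_lead_def)
        then show ?thesis by (rule "1.IH"[OF _ u qI])
      qed
      then have "?q + ?m * g y \<in> ?G" by (rule ideal_add[OF G _ ideal_mult[OF G gG[OF y(1)] mC]])
      then show ?case by simp
    qed
    have "I \<subseteq> ?G"
    proof
      fix p assume p: "p \<in> I"
      show "p \<in> ?G"
      proof (cases "p = 0")
        case True
        then show ?thesis using ideal_zero[OF G] by simp
      next
        case False
        then obtain v where "is_lead p v" by (rule lead_exists)
        then show ?thesis by (rule lead[OF _ p])
      qed
    qed
    moreover have "?G \<subseteq> I" by (rule R.genideal_minimal[OF I GI])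
    ultimately have "I = ?G" by (rule subset_antisym)
    then show "\<exists>A\<subseteq>carrier R. finite A \<and> I = genideal R A" using sub Y(1) by blast
  qed
qed

end

section \<open>Finite-dimensional residue fields\<close>

context cm_plane_monoid
begin

text \<open>
  The ring \<open>k[S]\<close> is a finite module over its subring \<open>k[u, w]\<close>. For a maximal ideal \<open>M\<close> the aim is that
  \<open>k[S] / M\<close> is finite-dimensional over \<open>k\<close>. The argument combines Noether normalization with a form of
  Zariski's lemma: a relation between \<open>u\<close> and \<open>w\<close> in \<open>M\<close> makes the residue field a finite module over \<open>k[t]\<close>
  for \<open>t = u - w\<^sup>N\<close>, and since \<open>t\<close> is either zero or invertible there, it is algebraic over \<open>k\<close>.
  Everything is phrased with subspaces of \<open>k[S]\<close> modulo \<open>M\<close>.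
\<close>

abbreviation u :: "(nat \<times> nat) \<Rightarrow>\<^sub>0 'k::field" where "u \<equiv> mon e1"
abbreviation w :: "(nat \<times> nat) \<Rightarrow>\<^sub>0 'k::field" where "w \<equiv> mon e2"

lemma u_polys [simp]: "u \<in> polys" and w_polys [simp]: "w \<in> polys"
  by (simp_all add: polys_single e1_mem e2_mem)

text \<open>
  If \<open>a = \<chi>\<^sup>e r a\<close>, then every point of the support of \<open>a\<close> is \<open>e\<close> plus further exponents plus another point of
  the support, which is impossible for a point with least coordinate sum.
\<close>

lemma one_minus_mon_cancel:
  fixes a :: "(nat \<times> nat) \<Rightarrow>\<^sub>0 'k::field"
  assumes "e \<noteq> 0" "(1 - mon e * r) * a = 0"
  shows "a = 0"
proof (rule ccontr)
  assume "a \<noteq> 0"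
  then have "Poly_Mapping.keys a \<noteq> {}" by simp
  then obtain v where v: "v \<in> Poly_Mapping.keys a"
    and min: "\<And>x. x \<in> Poly_Mapping.keys a \<Longrightarrow> coord_sum v \<le> coord_sum x"
    using ex_has_least_nat[of "\<lambda>v. v \<in> Poly_Mapping.keys a" _ coord_sum] by blast
  have "a = mon e * (r * a)" using assms(2) by (simp add: algebra_simps)
  then have "v \<in> Poly_Mapping.keys (mon e * (r * a))" using v by simp
  then obtain x where x: "x \<in> Poly_Mapping.keys (r * a)" "v = e + x" by (rule keys_single_mult_subset)
  then obtain y z where "x = y + z" "z \<in> Poly_Mapping.keys a" using keys_mult[of r a] by blast
  then show False using min[of z] x(2) coord_sum_pos[OF assms(1)] by simp
qed

text \<open>
  Either \<open>u \<in> M\<close>, or \<open>1 - u r \<in> M\<close> for some \<open>r\<close>. In the second case \<open>1 - u r\<close> is algebraically dependent on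
  \<open>u\<close> and \<open>w\<close>; being a nonzerodivisor, it can be cancelled from the relation until the lowest
  coefficient, a polynomial in \<open>u\<close> and \<open>w\<close>, is congruent to \<open>0\<close> modulo it.
\<close>

lemma exists_plane_relation:
  fixes M :: "((nat \<times> nat) \<Rightarrow>\<^sub>0 'k::field) set"
  assumes M: "maximalideal M R"
  obtains N c where "\<exists>i\<le>N. \<exists>j\<le>N. c i j \<noteq> (0::'k)"
    and "(\<Sum>i\<le>N. u ^ i * (\<Sum>j\<le>N. w ^ j * cst (c i j))) \<in> M"
proof (cases "(u :: (nat \<times> nat) \<Rightarrow>\<^sub>0 'k) \<in> M")
  case True
  define c :: "nat \<Rightarrow> nat \<Rightarrow> 'k" where "c i j = (if i = 1 \<and> j = 0 then 1 else 0)" for i j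
  have "(\<Sum>i\<le>1. u ^ i * (\<Sum>j\<le>1. w ^ j * cst (c i j))) \<in> M"
    using True by (simp add: c_def)
  moreover have "c 1 0 \<noteq> 0" by (simp add: c_def)
  then have "\<exists>i\<le>1. \<exists>j\<le>1. c i j \<noteq> 0" using le_refl[of "1::nat"] zero_le_one[where 'a=nat] by blast
  ultimately show thesis by (rule that[rotated])
next
  case False
  note I = maximalideal.axioms(1)[OF M]
  obtain r where r: "r \<in> polys" "1 - u * r \<in> M" by (rule maximalideal_inverse[OF M u_polys False])
  obtain N c where nz: "\<exists>i\<le>N. \<exists>j\<le>N. \<exists>l\<le>N. c i j l \<noteq> (0::'k)"
    and rel: "(\<Sum>i\<le>N. (1 - u * r) ^ i * (\<Sum>j\<le>N. u ^ j * (\<Sum>l\<le>N. w ^ l * cst (c i j l)))) = 0"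
    by (rule three_elements_algebraically_dependent)
  let ?q = "\<lambda>i. \<Sum>j\<le>N. u ^ j * (\<Sum>l\<le>N. w ^ l * cst (c i j l))"
  have "\<exists>i\<le>N. (\<exists>j\<le>N. \<exists>l\<le>N. c i j l \<noteq> 0) \<and> ?q i \<in> M"
  proof (rule lowest_coefficient_mem[OF I _ r(2), where P = "{0}"])
    show "{0} \<subseteq> M" using ideal_zero[OF I] by simp
    show "y \<in> {0}" if "(1 - u * r) * y \<in> {0}" for y
      using one_minus_mon_cancel[OF e1_nz] that by simp
    show "(\<Sum>i\<le>N. (1 - u * r) ^ i * ?q i) \<in> {0}" using rel by simp
    show "?q i \<in> polys" for i by (intro polys_sum polys_mult polys_power) simp_all
    show "?q i = 0" if "\<not> (\<exists>j\<le>N. \<exists>l\<le>N. c i j l \<noteq> 0)" for i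
      using that by simp
    show "\<exists>i\<le>N. \<exists>j\<le>N. \<exists>l\<le>N. c i j l \<noteq> 0" by (rule nz)
  qed
  then obtain i where "\<exists>j\<le>N. \<exists>l\<le>N. c i j l \<noteq> 0" "?q i \<in> M" by blast
  then show thesis by (rule that)
qed

text \<open>
  The filtration of \<open>S\<close> in which \<open>e\<^sub>1\<close> has weight \<open>N\<close> and \<open>e\<^sub>2\<close> has weight \<open>1\<close>. With these weights
  \<open>t = u - w\<^sup>N\<close> is homogeneous.
\<close>

definition layer :: "nat \<Rightarrow> nat \<Rightarrow> (nat \<times> nat) set" where
  "layer N d = {s + nmul x e1 + nmul y e2 | s x y. s \<in> B \<and> N * x + y \<le> d}"

lemma layerI: "s \<in> B \<Longrightarrow> N * x + y \<le> d \<Longrightarrow> s + nmul x e1 + nmul y e2 \<in> layer N d"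
  unfolding layer_def by blast

lemma layer_subset: "layer N d \<subseteq> S"
  using B_subset e1_mem e2_mem by (auto simp: layer_def intro!: add_mem nmul_mem)

lemma layer_mono: "d \<le> d' \<Longrightarrow> layer N d \<subseteq> layer N d'"
  unfolding layer_def using le_trans by blast

lemma finite_layer:
  assumes "N \<ge> 1" shows "finite (layer N d)"
proof (rule finite_subset)
  show "layer N d \<subseteq> (\<lambda>(s, x, y). s + nmul x e1 + nmul y e2) ` (B \<times> {..d} \<times> {..d})"
  proof
    fix v assume "v \<in> layer N d"
    then obtain s x y where v: "v = s + nmul x e1 + nmul y e2" "s \<in> B" "N * x + y \<le> d"
      unfolding layer_def by blast
    have "1 * x \<le> N * x" by (rule mult_le_mono1[OF assms])
    with v(3) have "x \<le> d" "y \<le> d" by linarith+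
    with v show "v \<in> (\<lambda>(s, x, y). s + nmul x e1 + nmul y e2) ` (B \<times> {..d} \<times> {..d})"
      by (intro image_eqI[of _ _ "(s, x, y)"]) auto
  qed
  show "finite ((\<lambda>(s, x, y). s + nmul x e1 + nmul y e2) ` (B \<times> {..d} \<times> {..d}))"
    using finite_B by simp
qed

lemma finite_subset_layer:
  assumes "finite A" "A \<subseteq> S" shows "\<exists>d. A \<subseteq> layer N d"
  using assms
proof (induction A rule: finite_induct)
  case (insert v A)
  then obtain d where d: "A \<subseteq> layer N d" by auto
  obtain s x y where v: "s \<in> B" "v = s + nmul x e1 + nmul y e2"
    using decompose[of v] insert.prems by auto
  have "v \<in> layer N (max d (N * x + y))" unfolding v(2) by (rule layerI[OF v(1)]) simp
  moreover have "A \<subseteq> layer N (max d (N * x + y))"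
    by (rule order_trans[OF d layer_mono]) simp
  ultimately show ?case by blast
qed simp

text \<open>
  The full preimage in \<open>k[S]\<close> of the image of a layer in \<open>k[S] / M\<close>. The preimage is used in place of the
  image to avoid quotient rings.
\<close>

definition quot_layer :: "((nat \<times> nat) \<Rightarrow>\<^sub>0 'k::field) set \<Rightarrow> nat \<Rightarrow> nat \<Rightarrow> ((nat \<times> nat) \<Rightarrow>\<^sub>0 'k) set" where
  "quot_layer M N d = {p. \<exists>y. Poly_Mapping.keys y \<subseteq> layer N d \<and> p - y \<in> M}"

lemma keys_layer_imp_quot_layer:
  "ideal M R \<Longrightarrow> Poly_Mapping.keys p \<subseteq> layer N d \<Longrightarrow> p \<in> quot_layer M N d"
  unfolding quot_layer_def using ideal_zero by (intro CollectI exI[of _ p]) simp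

lemma quot_layer_mod:
  assumes M: "ideal M R" and pq: "p - q \<in> M" and q: "q \<in> quot_layer M N d"
  shows "p \<in> quot_layer M N d"
proof -
  obtain y where y: "Poly_Mapping.keys y \<subseteq> layer N d" "q - y \<in> M" using q by (auto simp: quot_layer_def)
  have "p - y \<in> M" using ideal_add[OF M pq y(2)] by simp
  with y(1) show ?thesis by (auto simp: quot_layer_def)
qed

lemma quot_layer_mono: "d \<le> d' \<Longrightarrow> quot_layer M N d \<subseteq> quot_layer M N d'"
  using layer_mono[of d d' N] by (fastforce simp: quot_layer_def)

lemma quot_layer_zero: "ideal M R \<Longrightarrow> 0 \<in> quot_layer M N d"
  by (rule keys_layer_imp_quot_layer) simp_all

lemma quot_layer_add:
  assumes M: "ideal M R" and "p \<in> quot_layer M N d" "q \<in> quot_layer M N d"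
  shows "p + q \<in> quot_layer M N d"
proof -
  obtain y z where y: "Poly_Mapping.keys y \<subseteq> layer N d" "p - y \<in> M"
    and z: "Poly_Mapping.keys z \<subseteq> layer N d" "q - z \<in> M"
    using assms(2,3) by (auto simp: quot_layer_def)
  have "Poly_Mapping.keys (y + z) \<subseteq> layer N d" using y(1) z(1) keys_add[of y z] by blast
  moreover have "p + q - (y + z) \<in> M" using ideal_add[OF M y(2) z(2)] by (simp add: algebra_simps)
  ultimately show ?thesis by (auto simp: quot_layer_def)
qed

lemma quot_layer_cst_mult:
  assumes M: "ideal M R" and p: "p \<in> quot_layer M N d"
  shows "cst c * p \<in> quot_layer M N d"
proof -
  obtain y where y: "Poly_Mapping.keys y \<subseteq> layer N d" "p - y \<in> M" using p by (auto simp: quot_layer_def)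
  have "Poly_Mapping.keys (cst c * y) \<subseteq> layer N d" using keys_cst_mult_subset y(1) by blast
  moreover have "cst c * p - cst c * y \<in> M"
    using ideal_mult[OF M y(2) polys_cst[of c]] by (simp add: algebra_simps)
  ultimately show ?thesis by (auto simp: quot_layer_def)
qed

lemma quot_layer_uminus:
  assumes M: "ideal M R" and p: "p \<in> quot_layer M N d"
  shows "- p \<in> quot_layer M N d"
  using quot_layer_cst_mult[OF M p, of "- 1"] by (simp add: single_uminus)

lemma quot_layer_sum:
  assumes M: "ideal M R" and "\<And>i. i \<in> I \<Longrightarrow> p i \<in> quot_layer M N d"
  shows "(\<Sum>i\<in>I. p i) \<in> quot_layer M N d"
  using assms(2)
  by (induction I rule: infinite_finite_induct) (simp_all add: quot_layer_zero[OF M] quot_layer_add[OF M])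

text \<open>
  Since \<open>u = t + w\<^sup>N\<close>, factors \<open>u\<close> can be replaced by \<open>w\<^sup>N\<close> without changing the weight, at the cost of \<open>t\<close>
  times something of smaller weight. The truncated subtraction is harmless: at weight \<open>0\<close> nothing is replaced
  and \<open>a = 0\<close>.
\<close>

lemma trade_e1_for_e2:
  fixes t :: "(nat \<times> nat) \<Rightarrow>\<^sub>0 'k::field"
  assumes N: "N \<ge> 1" and t: "t = u - w ^ N" and s: "s \<in> B"
  shows "\<exists>a. Poly_Mapping.keys a \<subseteq> layer N (N * x + y - 1) \<and>
           u ^ x * w ^ y * mon s = t * a + w ^ (N * x + y) * mon s"
proof (induction x arbitrary: y)
  case 0
  show ?case by (intro exI[of _ 0]) simp
next
  case (Suc x)
  obtain a where a: "Poly_Mapping.keys a \<subseteq> layer N (N * x + (y + N) - 1)"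
    "u ^ x * w ^ (y + N) * mon s = t * a + w ^ (N * x + (y + N)) * mon s"
    using Suc.IH by blast
  let ?b = "u ^ x * w ^ y * mon s :: (nat \<times> nat) \<Rightarrow>\<^sub>0 'k"
  have eq: "N * Suc x + y = N * x + (y + N)" by simp
  have "?b = mon (s + nmul x e1 + nmul y e2)" by (simp add: mon_power mult_single ac_simps)
  moreover have "s + nmul x e1 + nmul y e2 \<in> layer N (N * Suc x + y - 1)"
    using N by (intro layerI[OF s]) simp
  ultimately have "Poly_Mapping.keys ?b \<subseteq> layer N (N * Suc x + y - 1)" by simp
  then have "Poly_Mapping.keys (?b + a) \<subseteq> layer N (N * Suc x + y - 1)"
    using a(1) keys_add[of ?b a] unfolding eq by blast
  moreover have "u ^ Suc x * w ^ y * mon s = t * (?b + a) + w ^ (N * Suc x + y) * mon s"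
  proof -
    have "u ^ Suc x * w ^ y * mon s = t * ?b + u ^ x * w ^ (y + N) * mon s"
      by (simp add: t algebra_simps power_add)
    also have "\<dots> = t * (?b + a) + w ^ (N * Suc x + y) * mon s"
      unfolding a(2) eq by (simp add: algebra_simps)
    finally show ?thesis .
  qed
  ultimately show ?case by blast
qed

text \<open>
  Let \<open>u\<^sup>i w\<^sup>j\<close> with \<open>i = i0\<close> and \<open>j = j0\<close> be the only term of top weight \<open>L\<close> in an element of \<open>M\<close>.
  Modulo multiples \<open>t a\<close> with \<open>a\<close> of smaller weight, all monomials over the same \<open>s\<close> of the same weight
  \<open>d + 1 \<ge> L\<close> agree, so each agrees with one that is a multiple of the top term, and this one is congruent modulo
  \<open>M\<close> to terms of smaller weight.
\<close>

lemma layer_reduction: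
  fixes t G :: "(nat \<times> nat) \<Rightarrow>\<^sub>0 'k::field"
  assumes M: "ideal M R" and N: "N \<ge> 1" and t: "t = u - w ^ N"
    and G: "G = (\<Sum>(i, j)\<in>A. cst (c i j) * (u ^ i * w ^ j))" "\<And>i j. (i, j) \<in> A \<Longrightarrow> N * i + j < L"
    and rel: "u ^ i0 * w ^ j0 + G \<in> M" "L = N * i0 + j0"
    and d: "L \<le> Suc d" and p: "Poly_Mapping.keys p \<subseteq> layer N (Suc d)"
  shows "\<exists>a b. Poly_Mapping.keys a \<subseteq> layer N d \<and> Poly_Mapping.keys b \<subseteq> layer N d \<and>
           p - t * a - b \<in> M"
  using p
proof (induction rule: keys_subset_induct)
  case zero
  show ?case using ideal_zero[OF M] by (intro exI[of _ 0]) simp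
next
  case (add p q)
  then obtain a b a' b' where *: "Poly_Mapping.keys a \<subseteq> layer N d" "Poly_Mapping.keys b \<subseteq> layer N d"
    "p - t * a - b \<in> M" "Poly_Mapping.keys a' \<subseteq> layer N d" "Poly_Mapping.keys b' \<subseteq> layer N d"
    "q - t * a' - b' \<in> M" by blast
  have "Poly_Mapping.keys (a + a') \<subseteq> layer N d" "Poly_Mapping.keys (b + b') \<subseteq> layer N d"
    using * keys_add[of a a'] keys_add[of b b'] by blast+
  moreover have "p + q - t * (a + a') - (b + b') \<in> M"
    using ideal_add[OF M *(3,6)] by (simp add: algebra_simps)
  ultimately show ?case by blast
next
  case (single v k)
  have "\<exists>a b. Poly_Mapping.keys a \<subseteq> layer N d \<and> Poly_Mapping.keys b \<subseteq> layer N d \<and>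
           mon v - t * a - b \<in> M"
  proof (cases "v \<in> layer N d")
    case True
    then have "Poly_Mapping.keys (0 :: (nat \<times> nat) \<Rightarrow>\<^sub>0 'k) \<subseteq> layer N d \<and>
        Poly_Mapping.keys (mon v :: (nat \<times> nat) \<Rightarrow>\<^sub>0 'k) \<subseteq> layer N d \<and> mon v - t * 0 - mon v \<in> M"
      using ideal_zero[OF M] by simp
    then show ?thesis by blast
  next
    case False
    obtain s x y where s: "s \<in> B" and v: "v = s + nmul x e1 + nmul y e2" and "N * x + y \<le> Suc d"
      using single unfolding layer_def by blast
    moreover have "\<not> N * x + y \<le> d" using layerI[OF s] False v by blast
    ultimately have D: "N * x + y = Suc d" by simp
    obtain a where a: "Poly_Mapping.keys a \<subseteq> layer N (N * x + y - 1)"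
      "u ^ x * w ^ y * mon s = t * a + w ^ (N * x + y) * mon s"
      using trade_e1_for_e2[OF N t s] by blast
    define z where "z = Suc d - L"
    have D': "N * i0 + (j0 + z) = Suc d" using d rel(2) by (simp add: z_def)
    obtain a' where a': "Poly_Mapping.keys a' \<subseteq> layer N (N * i0 + (j0 + z) - 1)"
      "u ^ i0 * w ^ (j0 + z) * mon s = t * a' + w ^ (N * i0 + (j0 + z)) * mon s"
      using trade_e1_for_e2[OF N t s] by blast
    define b where "b = - (w ^ z * mon s * G)"
    have sC: "w ^ z * mon s \<in> polys" using B_subset s by (intro polys_mult polys_power w_polys polys_single) blast
    have "w ^ z * mon s * G = (\<Sum>(i, j)\<in>A. cst (c i j) * mon (s + nmul i e1 + nmul (z + j) e2))"
      unfolding G(1) sum_distrib_left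
      by (rule sum.cong) (auto simp: mon_power nmul_add mult_single ac_simps)
    also have "Poly_Mapping.keys \<dots> \<subseteq> layer N d"
    proof (rule keys_sum_subset, clarify)
      fix i j v assume "(i, j) \<in> A"
        and v: "v \<in> Poly_Mapping.keys (cst (c i j) * (mon (s + nmul i e1 + nmul (z + j) e2) :: _ \<Rightarrow>\<^sub>0 'k))"
      then have "N * i + j < L" using G(2) by blast
      then have "N * i + (z + j) \<le> d" using d by (simp add: z_def)
      then have "s + nmul i e1 + nmul (z + j) e2 \<in> layer N d" by (rule layerI[OF s])
      moreover have "v = s + nmul i e1 + nmul (z + j) e2"
        using subsetD[OF keys_cst_mult_subset v] by simp
      ultimately show "v \<in> layer N d" by simp
    qed
    finally have b: "Poly_Mapping.keys b \<subseteq> layer N d" by (simp add: b_def keys_uminus)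
    have aa: "Poly_Mapping.keys (a - a') \<subseteq> layer N d"
      using a(1) a'(1) keys_minus_subset[of a a'] D D' by auto
    have "mon v = u ^ x * w ^ y * mon s" by (simp add: v mon_power mult_single ac_simps)
    also have "\<dots> = t * (a - a') + u ^ i0 * w ^ (j0 + z) * mon s"
      unfolding a(2) a'(2) D D' by (simp add: algebra_simps)
    also have "u ^ i0 * w ^ (j0 + z) * mon s = w ^ z * mon s * (u ^ i0 * w ^ j0 + G) + b"
      by (simp add: b_def algebra_simps power_add)
    finally have "mon v - t * (a - a') - b = w ^ z * mon s * (u ^ i0 * w ^ j0 + G)" by simp
    then have "mon v - t * (a - a') - b \<in> M" using ideal_mult[OF M rel(1) sC] by simp
    with aa b show ?thesis by blast
  qed
  then obtain a b where ab: "Poly_Mapping.keys a \<subseteq> layer N d" "Poly_Mapping.keys b \<subseteq> layer N d"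
    "mon v - t * a - b \<in> M" by blast
  have "Poly_Mapping.single v k - t * (cst k * a) - cst k * b = cst k * (mon v - t * a - b)"
    by (simp add: single_eq_cst_mult[of v k] algebra_simps)
  then have "Poly_Mapping.single v k - t * (cst k * a) - cst k * b \<in> M"
    using ideal_mult[OF M ab(3) polys_cst[of k]] by simp
  moreover have "Poly_Mapping.keys (cst k * a) \<subseteq> layer N d" "Poly_Mapping.keys (cst k * b) \<subseteq> layer N d"
    using ab(1,2) keys_cst_mult_subset by blast+
  ultimately show ?case by blast
qed

lemma dependent_mod_ideal:
  fixes f :: "nat \<Rightarrow> (nat \<times> nat) \<Rightarrow>\<^sub>0 'k::field"
  assumes M: "ideal M R" and N: "N \<ge> 1" and f: "\<And>i. f i \<in> quot_layer M N d"
  obtains n c where "\<exists>i\<le>n. c i \<noteq> 0" "(\<Sum>i\<le>n. f i * cst (c i)) \<in> M"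
proof -
  have "\<forall>i. \<exists>y. Poly_Mapping.keys y \<subseteq> layer N d \<and> f i - y \<in> M"
    using f by (simp add: quot_layer_def)
  then obtain y where y: "\<And>i. Poly_Mapping.keys (y i) \<subseteq> layer N d" "\<And>i. f i - y i \<in> M" by metis
  let ?n = "card (layer N d)"
  obtain c where c: "\<exists>i\<in>{..?n}. c i \<noteq> 0" "(\<Sum>i\<le>?n. cst (c i) * y i) = 0"
    using exists_linear_dependence[of "{..?n}" "layer N d" y] finite_layer[OF N] y(1) by auto
  have "(\<Sum>i\<le>?n. cst (c i) * (f i - y i)) \<in> M"
    by (intro ideal_sum[OF M] ideal_mult[OF M] y(2) polys_cst)
  also have "(\<Sum>i\<le>?n. cst (c i) * (f i - y i)) = (\<Sum>i\<le>?n. f i * cst (c i))"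
    using c(2) by (simp add: right_diff_distrib sum_subtractf mult.commute)
  finally show thesis using c(1) that[of ?n c] by auto
qed

text \<open>
  Write \<open>K\<^sub>d\<close> for \<open>quot_layer M N d\<close>, so that the hypothesis reads \<open>K\<^sub>d\<^sub>+\<^sub>1 \<subseteq> t K\<^sub>d + K\<^sub>d\<close> for large \<open>d\<close>. As soon as
  \<open>t K\<^sub>c \<subseteq> K\<^sub>c\<close> for one large \<open>c\<close>, induction gives \<open>K\<^sub>d \<subseteq> K\<^sub>c\<close> for all \<open>d\<close>. If \<open>t \<in> M\<close>, such a \<open>c\<close> is immediate.
  Otherwise let \<open>r\<close> be an inverse of \<open>t\<close> modulo \<open>M\<close>. Multiplying the hypothesis by \<open>r\<close> shows that \<open>r\<close> maps
  \<open>K\<^sub>d\<^sub>+\<^sub>1\<close> into \<open>K\<^sub>d + r K\<^sub>d\<close>, hence preserves \<open>K\<^sub>c\<close> once \<open>c\<close> is so large that \<open>K\<^sub>c\<close> contains \<open>r K\<^sub>L\<close>. Now \<open>K\<^sub>c\<close> is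
  finite-dimensional modulo \<open>M\<close>, so \<open>r\<close> satisfies an algebraic equation, which expresses its inverse \<open>t\<close> as a
  polynomial in \<open>r\<close>. Therefore \<open>t\<close> preserves \<open>K\<^sub>c\<close> as well.
\<close>

lemma residue_field_finite_dimensional_of_reduction:
  fixes t :: "(nat \<times> nat) \<Rightarrow>\<^sub>0 'k::field"
  assumes max: "maximalideal M R" and N: "N \<ge> 1" and tC: "t \<in> polys"
    and red: "\<And>d p. \<lbrakk>L \<le> Suc d; Poly_Mapping.keys p \<subseteq> layer N (Suc d)\<rbrakk> \<Longrightarrow>
      \<exists>a b. Poly_Mapping.keys a \<subseteq> layer N d \<and> Poly_Mapping.keys b \<subseteq> layer N d \<and> p - t * a - b \<in> M"
  shows "\<exists>d. polys \<subseteq> quot_layer M N d"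
proof -
  note M = maximalideal.axioms(1)[OF max]
  have prime: "primeideal M R" by (rule cring.maximalideal_prime[OF cring_semigroup_ring max])
  let ?K = "quot_layer M N"
  have stable: "\<exists>c\<ge>L. \<forall>p. Poly_Mapping.keys p \<subseteq> layer N c \<longrightarrow> t * p \<in> ?K c"
  proof (cases "t \<in> M")
    case True
    have "t * p \<in> ?K L" if p: "Poly_Mapping.keys p \<subseteq> layer N L" for p
    proof -
      have "p \<in> polys" using p layer_subset by (auto simp: polys_def)
      then have "t * p - 0 \<in> M" using ideal_mult[OF M True] by (simp add: mult.commute)
      then show ?thesis by (rule quot_layer_mod[OF M _ quot_layer_zero[OF M]])
    qed
    then show ?thesis by blast
  next
    case False
    obtain r where r: "r \<in> polys" "1 - t * r \<in> M" by (rule maximalideal_inverse[OF max tC False])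
    have rM: "r \<notin> M"
    proof
      assume "r \<in> M"
      then have "(1 - t * r) + t * r \<in> M" by (intro ideal_add[OF M r(2)] ideal_mult[OF M _ tC])
      then have "cst 1 \<in> M" by simp
      then have "(1::'k) = 0" by (rule proper_ideal_cst[OF M maximalideal.I_notcarr[OF max, symmetric]])
      then show False by simp
    qed
    define E where "E = insert 0 (\<Union>x\<in>Poly_Mapping.keys r. (\<lambda>y. x + y) ` layer N L)"
    have "finite E" using finite_layer[OF N] by (simp add: E_def)
    moreover have "E \<subseteq> S" using r(1) layer_subset add_mem unfolding E_def polys_def by fastforce
    ultimately obtain c0 where c0: "E \<subseteq> layer N c0" using finite_subset_layer by blast
    define c where "c = max L c0"
    have Ec: "E \<subseteq> layer N c" using c0 layer_mono[of c0 c] by (auto simp: c_def)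
    have rL: "r * p \<in> ?K c" if "Poly_Mapping.keys p \<subseteq> layer N L" for p
    proof (rule keys_layer_imp_quot_layer[OF M])
      show "Poly_Mapping.keys (r * p) \<subseteq> layer N c" using that Ec keys_mult[of r p] unfolding E_def by blast
    qed
    have rK: "\<forall>p. Poly_Mapping.keys p \<subseteq> layer N d \<longrightarrow> r * p \<in> ?K (max d c)" if "L \<le> d" for d
      using that
    proof (induction d rule: dec_induct)
      case base
      have "max L c = c" by (simp add: c_def)
      then show ?case using rL by simp
    next
      case (step d)
      show ?case
      proof (intro allI impI)
        fix p :: "(nat \<times> nat) \<Rightarrow>\<^sub>0 'k" assume p: "Poly_Mapping.keys p \<subseteq> layer N (Suc d)"
        obtain a b where ab: "Poly_Mapping.keys a \<subseteq> layer N d" "Poly_Mapping.keys b \<subseteq> layer N d"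
          "p - t * a - b \<in> M"
          using red[OF _ p] step.hyps by force
        have aC: "a \<in> polys" using ab(1) layer_subset by (auto simp: polys_def)
        have "r * (p - t * a - b) - a * (1 - t * r) \<in> M"
          by (rule ideal_diff[OF M ideal_mult[OF M ab(3) r(1)] ideal_mult[OF M r(2) aC]])
        then have diff: "r * p - (a + r * b) \<in> M" by (simp add: algebra_simps)
        have "a \<in> ?K (max (Suc d) c)"
          by (rule keys_layer_imp_quot_layer[OF M order_trans[OF ab(1) layer_mono]]) simp
        moreover have "r * b \<in> ?K (max d c)" using step.IH ab(2) by blast
        then have "r * b \<in> ?K (max (Suc d) c)"
          by (rule subsetD[OF quot_layer_mono, rotated]) simp
        ultimately have "a + r * b \<in> ?K (max (Suc d) c)" by (rule quot_layer_add[OF M])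
        then show "r * p \<in> ?K (max (Suc d) c)" by (rule quot_layer_mod[OF M diff])
      qed
    qed
    have rc: "r * p \<in> ?K c" if p: "p \<in> ?K c" for p
    proof -
      obtain y where y: "Poly_Mapping.keys y \<subseteq> layer N c" "p - y \<in> M"
        using p by (auto simp: quot_layer_def)
      have "r * y \<in> ?K c" using rK[of c] y(1) by (simp add: c_def)
      moreover have "r * p - r * y \<in> M" using ideal_mult[OF M y(2) r(1)] by (simp add: algebra_simps)
      ultimately show ?thesis by (rule quot_layer_mod[OF M, rotated])
    qed
    have rpow: "r ^ i * p \<in> ?K c" if "p \<in> ?K c" for i p
    proof (induction i)
      case (Suc i)
      then show ?case using rc[OF Suc] by (simp add: mult.assoc)
    qed (use that in simp)
    have "1 \<in> ?K c" by (rule keys_layer_imp_quot_layer[OF M]) (use Ec E_def in auto)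
    then have "r ^ i \<in> ?K c" for i using rpow[of 1 i] by simp
    then obtain n k where k: "\<exists>i\<le>n. k i \<noteq> 0" "(\<Sum>i\<le>n. r ^ i * cst (k i)) \<in> M"
      by (rule dependent_mod_ideal[where f = "\<lambda>i. r ^ i" and d = c, OF M N])
    define m where "m = (LEAST i. k i \<noteq> 0)"
    obtain i where i: "i \<le> n" "k i \<noteq> 0" using k(1) by blast
    have m: "k m \<noteq> 0" unfolding m_def by (rule LeastI[of _ i]) (rule i(2))
    have mn: "m \<le> n" unfolding m_def using Least_le[of "\<lambda>i. k i \<noteq> 0" i] i by simp
    have low: "cst (k i) = (0 :: (nat \<times> nat) \<Rightarrow>\<^sub>0 'k)" if "i < m" for i
      using not_less_Least[of i "\<lambda>i. k i \<noteq> 0"] that by (simp add: m_def)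
    \<comment> \<open>After cancelling \<open>r\<^sup>m\<close> the equation reads \<open>k\<^sub>m + r h \<in> M\<close>, that is, \<open>k\<^sub>m t\<close> is congruent to \<open>- h\<close>.\<close>
    define h where "h = (\<Sum>j<n - m. r ^ j * cst (k (Suc (m + j))))"
    have hC: "h \<in> polys" unfolding h_def using r(1) by (intro polys_sum polys_mult polys_power polys_cst)
    have rm: "r ^ m * (cst (k m) + r * h) \<in> M"
      using k(2) sum_powers_factor_lowest[of m n "\<lambda>i. cst (k i)" r, OF mn low] by (simp add: h_def)
    have cancel: "y \<in> M" if "y \<in> polys" "r * y \<in> M" for y
      by (rule primeideal_cancel[OF prime r(1) rM that])
    have "cst (k m) + r * h \<in> polys" by (intro polys_add polys_cst polys_mult r(1) hC)
    from power_cancel[OF cancel r(1) this rm] have km: "cst (k m) + r * h \<in> M" .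
    have "t * p \<in> ?K c" if p: "Poly_Mapping.keys p \<subseteq> layer N c" for p
    proof -
      have pK: "p \<in> ?K c" by (rule keys_layer_imp_quot_layer[OF M p])
      have pC: "p \<in> polys" using p layer_subset by (auto simp: polys_def)
      have "h * p = (\<Sum>j<n - m. cst (k (Suc (m + j))) * (r ^ j * p))"
        by (simp add: h_def sum_distrib_left sum_distrib_right mult_ac)
      also have "\<dots> \<in> ?K c" by (intro quot_layer_sum[OF M] quot_layer_cst_mult[OF M] rpow pK)
      finally have hp: "- (h * p) \<in> ?K c" by (rule quot_layer_uminus[OF M])
      have "(t * p) * (cst (k m) + r * h) + (h * p) * (1 - t * r) \<in> M"
        by (intro ideal_add[OF M ideal_mult[OF M km] ideal_mult[OF M r(2)]] polys_mult tC pC hC)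
      then have "cst (k m) * (t * p) - (- (h * p)) \<in> M" by (simp add: algebra_simps)
      then have "cst (k m) * (t * p) \<in> ?K c" by (rule quot_layer_mod[OF M _ hp])
      then have "cst (inverse (k m)) * (cst (k m) * (t * p)) \<in> ?K c" by (rule quot_layer_cst_mult[OF M])
      also have "cst (inverse (k m)) * (cst (k m) * (t * p)) = t * p"
        using m by (simp add: mult.assoc[symmetric] cst_mult_cst)
      finally show ?thesis .
    qed
    then show ?thesis by (intro exI[of _ c]) (simp add: c_def)
  qed
  then obtain c where c: "L \<le> c" "\<And>p. Poly_Mapping.keys p \<subseteq> layer N c \<Longrightarrow> t * p \<in> ?K c" by blast
  have tK: "t * p \<in> ?K c" if p: "p \<in> ?K c" for p
  proof -
    obtain y where y: "Poly_Mapping.keys y \<subseteq> layer N c" "p - y \<in> M"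
      using p by (auto simp: quot_layer_def)
    have "t * p - t * y \<in> M" using ideal_mult[OF M y(2) tC] by (simp add: algebra_simps)
    then show ?thesis by (rule quot_layer_mod[OF M _ c(2)[OF y(1)]])
  qed
  have all: "\<forall>p. Poly_Mapping.keys p \<subseteq> layer N d \<longrightarrow> p \<in> ?K c" for d
  proof (induction d)
    case 0
    show ?case using keys_layer_imp_quot_layer[OF M] layer_mono[of 0 c N] by blast
  next
    case (Suc d)
    show ?case
    proof (intro allI impI)
      fix p :: "(nat \<times> nat) \<Rightarrow>\<^sub>0 'k" assume p: "Poly_Mapping.keys p \<subseteq> layer N (Suc d)"
      show "p \<in> ?K c"
      proof (cases "Suc d \<le> c")
        case True
        then show ?thesis using keys_layer_imp_quot_layer[OF M] p layer_mono[OF True, of N] by blast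
      next
        case False
        then obtain a b where ab: "Poly_Mapping.keys a \<subseteq> layer N d" "Poly_Mapping.keys b \<subseteq> layer N d"
          "p - t * a - b \<in> M" using red[OF _ p] c(1) by force
        have "t * a + b \<in> ?K c" using Suc ab(1,2) by (intro quot_layer_add[OF M] tK) auto
        moreover have "p - (t * a + b) \<in> M" using ab(3) by (simp add: algebra_simps)
        ultimately show ?thesis by (rule quot_layer_mod[OF M, rotated])
      qed
    qed
  qed
  have "polys \<subseteq> ?K c"
  proof
    fix p :: "(nat \<times> nat) \<Rightarrow>\<^sub>0 'k" assume "p \<in> polys"
    then obtain d where "Poly_Mapping.keys p \<subseteq> layer N d"
      using finite_subset_layer[of "Poly_Mapping.keys p" N] by (auto simp: polys_def)
    then show "p \<in> ?K c" using all by blast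
  qed
  then show ?thesis by blast
qed


lemma residue_field_finite_dimensional:
  fixes M :: "((nat \<times> nat) \<Rightarrow>\<^sub>0 'k::field) set"
  assumes max: "maximalideal M R"
  obtains N d where "N \<ge> 1" "polys \<subseteq> quot_layer M N d"
proof -
  note M = maximalideal.axioms(1)[OF max]
  obtain n c where nz: "\<exists>i\<le>n. \<exists>j\<le>n. c i j \<noteq> (0::'k)"
    and rel: "(\<Sum>i\<le>n. u ^ i * (\<Sum>j\<le>n. w ^ j * cst (c i j))) \<in> M"
    by (rule exists_plane_relation[OF max])
  \<comment> \<open>With this weight the monomials \<open>u\<^sup>i w\<^sup>j\<close> for \<open>i, j \<le> n\<close> have distinct weights: \<open>i\<close> and \<open>j\<close> are the digits of
      the weight to base \<open>N\<close>. So the relation has a unique term of top weight.\<close>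
  define N where "N = Suc n"
  define A where "A = {(i, j). i \<le> n \<and> j \<le> n \<and> c i j \<noteq> 0}"
  define wt where "wt = (\<lambda>(i, j). N * i + j)"
  have finA: "finite A" by (rule finite_subset[of _ "{..n} \<times> {..n}"]) (auto simp: A_def)
  have "A \<noteq> {}" using nz by (auto simp: A_def)
  then have "Max (wt ` A) \<in> wt ` A" using finA by (intro Max_in) auto
  then obtain i0 j0 where ij: "(i0, j0) \<in> A" "Max (wt ` A) = N * i0 + j0" by (auto simp: wt_def)
  define L where "L = N * i0 + j0"
  have le: "N * i + j \<le> L" if "(i, j) \<in> A" for i j
  proof -
    have "wt (i, j) \<le> Max (wt ` A)" using finA that by simp
    then show ?thesis using ij(2) by (simp add: wt_def L_def)
  qed
  have less: "N * i + j < L" if ij': "(i, j) \<in> A - {(i0, j0)}" for i j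
  proof (rule ccontr)
    assume "\<not> N * i + j < L"
    then have eq: "N * i + j = N * i0 + j0" using le[of i j] ij' by (auto simp: L_def)
    have jj: "j < N" "j0 < N" using ij' ij(1) by (auto simp: A_def N_def)
    have "i = (N * i + j) div N" "i0 = (N * i0 + j0) div N" using jj by simp_all
    then have "i = i0" using eq by simp
    then show False using eq ij' by simp
  qed
  let ?k = "c i0 j0"
  have k: "?k \<noteq> 0" using ij(1) by (simp add: A_def)
  define G where "G = (\<Sum>(i, j)\<in>A - {(i0, j0)}. cst (c i j / ?k) * (u ^ i * w ^ j :: (nat \<times> nat) \<Rightarrow>\<^sub>0 'k))"
  have "(\<Sum>i\<le>n. u ^ i * (\<Sum>j\<le>n. w ^ j * cst (c i j)))
      = (\<Sum>(i, j)\<in>{..n} \<times> {..n}. cst (c i j) * (u ^ i * w ^ j))"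
    by (simp add: sum_distrib_left sum.cartesian_product' mult_ac)
  also have "\<dots> = (\<Sum>(i, j)\<in>A. cst (c i j) * (u ^ i * w ^ j))"
    by (rule sum.mono_neutral_right) (auto simp: A_def)
  finally have "(\<Sum>(i, j)\<in>A. cst (c i j) * (u ^ i * w ^ j)) \<in> M" using rel by simp
  from ideal_mult[OF M this polys_cst[of "inverse ?k"]]
  have "(\<Sum>(i, j)\<in>A. cst (inverse ?k) * (cst (c i j) * (u ^ i * w ^ j))) \<in> M"
    by (simp add: sum_distrib_left case_prod_unfold)
  also have "(\<Sum>(i, j)\<in>A. cst (inverse ?k) * (cst (c i j) * (u ^ i * w ^ j)))
      = (\<Sum>(i, j)\<in>A. cst (c i j / ?k) * (u ^ i * w ^ j))"
    unfolding mult.assoc[symmetric] cst_mult_cst by (simp add: divide_inverse mult.commute[of "inverse ?k"])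
  also have "\<dots> = u ^ i0 * w ^ j0 + G"
    unfolding G_def using k by (subst sum.remove[OF finA ij(1)]) simp
  finally have rel': "u ^ i0 * w ^ j0 + G \<in> M" .
  have N1: "N \<ge> 1" by (simp add: N_def)
  let ?t = "u - w ^ N :: (nat \<times> nat) \<Rightarrow>\<^sub>0 'k"
  have "\<exists>d. polys \<subseteq> quot_layer M N d"
  proof (rule residue_field_finite_dimensional_of_reduction[OF max N1, of ?t L])
    show "?t \<in> polys" by (intro polys_diff polys_power u_polys w_polys)
    fix d and p :: "(nat \<times> nat) \<Rightarrow>\<^sub>0 'k"
    assume d: "L \<le> Suc d" and p: "Poly_Mapping.keys p \<subseteq> layer N (Suc d)"
    show "\<exists>a b. Poly_Mapping.keys a \<subseteq> layer N d \<and> Poly_Mapping.keys b \<subseteq> layer N d \<and> p - ?t * a - b \<in> M"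
      by (rule layer_reduction[OF M N1 refl G_def less rel' L_def d p])
  qed
  then show thesis using that N1 by blast
qed

lemma maximalideal_contains_polynomial:
  fixes M :: "((nat \<times> nat) \<Rightarrow>\<^sub>0 'k::field) set"
  assumes max: "maximalideal M R" and x: "x \<in> polys"
  obtains n c where "c n \<noteq> 0" "(\<Sum>i\<le>n. x ^ i * cst (c i)) \<in> M"
proof -
  obtain N d where N: "N \<ge> 1" and d: "polys \<subseteq> quot_layer M N d"
    by (rule residue_field_finite_dimensional[OF max])
  have "x ^ i \<in> quot_layer M N d" for i using d x polys_power by blast
  then obtain n c where c: "\<exists>i\<le>n. c i \<noteq> 0" "(\<Sum>i\<le>n. x ^ i * cst (c i)) \<in> M"
    by (rule dependent_mod_ideal[where f = "\<lambda>i. x ^ i" and d = d, OF maximalideal.axioms(1)[OF max] N])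
  define m where "m = Max {i. i \<le> n \<and> c i \<noteq> 0}"
  have fin: "finite {i. i \<le> n \<and> c i \<noteq> 0}" by simp
  have "m \<in> {i. i \<le> n \<and> c i \<noteq> 0}" unfolding m_def using c(1) fin by (intro Max_in) auto
  then have m: "m \<le> n" "c m \<noteq> 0" by simp_all
  have "c i = 0" if "i \<in> {..n} - {..m}" for i
    using Max_ge[OF fin, of i] that by (auto simp: m_def[symmetric])
  then have "(\<Sum>i\<le>n. x ^ i * cst (c i)) = (\<Sum>i\<le>m. x ^ i * cst (c i))"
    using m(1) by (intro sum.mono_neutral_right) auto
  with c(2) m(2) show thesis by (intro that[of c m]) simp_all
qed

end

section \<open>Regular sequences in maximal ideals\<close>

lemma lookup_poly_in_mon_mult:
  fixes a :: "(nat \<times> nat) \<Rightarrow>\<^sub>0 'k::field"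
  shows "Poly_Mapping.lookup ((\<Sum>i\<le>n. mon e ^ i * cst (c i)) * a) (v + nmul n e)
    = (\<Sum>i\<le>n. c i * Poly_Mapping.lookup a (v + nmul (n - i) e))"
proof -
  have "Poly_Mapping.lookup (mon e ^ i * cst (c i) * a) (v + nmul n e) =
      c i * Poly_Mapping.lookup a (v + nmul (n - i) e)" if "i \<le> n" for i
  proof -
    have "mon e ^ i * cst (c i) = Poly_Mapping.single (nmul i e) (c i)" by (simp add: mon_power mult_single)
    moreover have "v + nmul n e = nmul i e + (v + nmul (n - i) e)"
      using nmul_add[of i "n - i" e] that by (simp add: ac_simps)
    ultimately show ?thesis by (simp add: lookup_single_mult)
  qed
  then show ?thesis by (simp add: sum_distrib_right lookup_sum)
qed

text \<open>
  A point of the support of \<open>a\<close> with greatest coordinate sum has no other point of the support beyond it in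
  direction \<open>e\<close>, so its translate by \<open>n e\<close> receives only one contribution. In particular, nonzero polynomials
  in \<open>\<chi>\<^sup>e\<close> are nonzerodivisors.
\<close>

lemma poly_in_mon_mult_top:
  fixes a :: "(nat \<times> nat) \<Rightarrow>\<^sub>0 'k::field"
  assumes e: "e \<noteq> 0" and c: "c n \<noteq> 0" and a: "a \<noteq> 0"
  shows "\<exists>v\<in>Poly_Mapping.keys a. v + nmul n e \<in> Poly_Mapping.keys ((\<Sum>i\<le>n. mon e ^ i * cst (c i)) * a)"
proof -
  have ne: "coord_sum ` Poly_Mapping.keys a \<noteq> {}" using a by simp
  then have "Max (coord_sum ` Poly_Mapping.keys a) \<in> coord_sum ` Poly_Mapping.keys a" by (intro Max_in) auto
  then obtain v where v: "v \<in> Poly_Mapping.keys a" "Max (coord_sum ` Poly_Mapping.keys a) = coord_sum v" by auto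
  have "Poly_Mapping.lookup a (v + nmul (n - i) e) = 0" if "i < n" for i
  proof (rule ccontr)
    assume "Poly_Mapping.lookup a (v + nmul (n - i) e) \<noteq> 0"
    then have "v + nmul (n - i) e \<in> Poly_Mapping.keys a" by (simp add: in_keys_iff)
    then have "coord_sum (v + nmul (n - i) e) \<le> coord_sum v"
      unfolding v(2)[symmetric] by (intro Max_ge finite_imageI finite_keys imageI)
    then show False using that coord_sum_pos[OF e] by simp
  qed
  then have "(\<Sum>i\<le>n. c i * Poly_Mapping.lookup a (v + nmul (n - i) e)) = c n * Poly_Mapping.lookup a v"
    by (subst sum.mono_neutral_right[of _ "{n}"]) auto
  then have "v + nmul n e \<in> Poly_Mapping.keys ((\<Sum>i\<le>n. mon e ^ i * cst (c i)) * a)"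
    using c v(1) by (simp add: in_keys_iff lookup_poly_in_mon_mult)
  with v(1) show ?thesis by blast
qed

context cm_plane_monoid
begin

text \<open>The remainders of division by a polynomial of degree \<open>n\<close> in \<open>u\<close>.\<close>

definition reduced :: "nat \<Rightarrow> ((nat \<times> nat) \<Rightarrow>\<^sub>0 'k::field) \<Rightarrow> bool" where
  "reduced n r \<longleftrightarrow> (\<forall>v\<in>Poly_Mapping.keys r. \<forall>d\<in>S. v \<noteq> d + nmul n e1)"

lemma division:
  fixes a :: "(nat \<times> nat) \<Rightarrow>\<^sub>0 'k::field"
  assumes c: "c n \<noteq> 0" and a: "Poly_Mapping.keys a \<subseteq> S"
  shows "\<exists>q r. q \<in> polys \<and> r \<in> polys \<and> reduced n r \<and> a = (\<Sum>i\<le>n. u ^ i * cst (c i)) * q + r"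
proof -
  let ?p = "\<Sum>i\<le>n. u ^ i * cst (c i)"
  let ?D = "\<lambda>a. \<exists>q r. q \<in> polys \<and> r \<in> polys \<and> reduced n r \<and> a = ?p * q + r"
  have add: "?D (a + b)" if "?D a" "?D b" for a b
  proof -
    obtain q r q' r' where *: "q \<in> polys" "r \<in> polys" "reduced n r" "a = ?p * q + r"
      "q' \<in> polys" "r' \<in> polys" "reduced n r'" "b = ?p * q' + r'" using \<open>?D a\<close> \<open>?D b\<close> by blast
    have "reduced n (r + r')" using *(3,7) keys_add[of r r'] unfolding reduced_def by blast
    moreover have "a + b = ?p * (q + q') + (r + r')" unfolding *(4,8) by (simp add: algebra_simps)
    ultimately show ?thesis using *(1,2,5,6) polys_add by blast
  qed
  have zero: "?D 0" by (intro exI[of _ 0]) (simp add: reduced_def)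
  have sum: "?D (\<Sum>i\<in>I. f i)" if "\<And>i. i \<in> I \<Longrightarrow> ?D (f i)" for I :: "nat set" and f
    using that by (induction I rule: infinite_finite_induct) (simp_all only: sum.infinite sum.empty sum.insert zero add insert_iff simp_thms)
  have single: "?D (Poly_Mapping.single v k)" if "v \<in> S" for v k
    using that
  proof (induction "coord_sum v" arbitrary: v k rule: less_induct)
    case less
    show ?case
    proof (cases "\<exists>d\<in>S. v = d + nmul n e1")
      case False
      then have "reduced n (Poly_Mapping.single v k)" by (auto simp: reduced_def)
      moreover have "Poly_Mapping.single v k \<in> polys" by (rule polys_single[OF less.prems])
      moreover have "Poly_Mapping.single v k = ?p * 0 + Poly_Mapping.single v k" by simp
      ultimately show ?thesis using polys_0 by blast
    next
      case True
      then obtain d where d: "d \<in> S" "v = d + nmul n e1" by blast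
      define k' where "k' = k / c n"
      have "?p * Poly_Mapping.single d k' = (\<Sum>i\<le>n. Poly_Mapping.single (d + nmul i e1) (c i * k'))"
        unfolding sum_distrib_right by (intro sum.cong) (simp_all add: mon_power mult_single add.commute)
      also have "\<dots> = (\<Sum>i<n. Poly_Mapping.single (d + nmul i e1) (c i * k')) + Poly_Mapping.single v k"
        using c by (simp add: lessThan_Suc_atMost[symmetric] d(2) k'_def)
      finally have eq: "Poly_Mapping.single v k = ?p * Poly_Mapping.single d k'
          + (\<Sum>i<n. Poly_Mapping.single (d + nmul i e1) (- (c i * k')))"
        by (simp add: single_uminus sum_negf)
      have "?D (Poly_Mapping.single (d + nmul i e1) (- (c i * k')))" if "i < n" for i
      proof (rule less.hyps)
        show "coord_sum (d + nmul i e1) < coord_sum v" using that coord_sum_pos[OF e1_nz] by (simp add: d(2))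
        show "d + nmul i e1 \<in> S" by (intro add_mem d(1) nmul_mem e1_mem)
      qed
      then have "?D (\<Sum>i<n. Poly_Mapping.single (d + nmul i e1) (- (c i * k')))" by (intro sum) simp
      moreover have "reduced n 0" "?p * Poly_Mapping.single d k' = ?p * Poly_Mapping.single d k' + 0"
        by (simp_all add: reduced_def)
      then have "?D (?p * Poly_Mapping.single d k')" using polys_single[OF d(1)] polys_0 by blast
      ultimately show ?thesis unfolding eq by (intro add)
    qed
  qed
  show ?thesis using a by (induction rule: keys_subset_induct) (fact zero, erule (1) add, erule single)
qed

lemma reduced_multiple_eq_0:
  fixes q :: "(nat \<times> nat) \<Rightarrow>\<^sub>0 'k::field"
  assumes "c n \<noteq> 0" "q \<in> polys" "reduced n ((\<Sum>i\<le>n. u ^ i * cst (c i)) * q)"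
  shows "q = 0"
proof (rule ccontr)
  assume "q \<noteq> 0"
  from poly_in_mon_mult_top[where c = c and n = n, OF e1_nz assms(1) this]
  obtain v where "v \<in> Poly_Mapping.keys q"
    "v + nmul n e1 \<in> Poly_Mapping.keys ((\<Sum>i\<le>n. u ^ i * cst (c i)) * q)" by blast
  with assms(2,3) show False unfolding reduced_def polys_def by blast
qed

text \<open>
  If a translate \<open>x + j e\<^sub>2\<close> of a point \<open>x \<in> S\<close> lies in \<open>S + n e\<^sub>1\<close>, then by \<open>parallelogram\<close> so does \<open>x\<close>. This
  is the step where the geometry of \<open>S\<close> enters the depth.
\<close>

lemma reduced_mult:
  fixes r :: "(nat \<times> nat) \<Rightarrow>\<^sub>0 'k::field"
  assumes r: "r \<in> polys" "reduced n r"
  shows "reduced n ((\<Sum>j\<le>m. w ^ j * cst (k j)) * r)"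
  unfolding reduced_def
proof (intro ballI notI)
  fix v d assume v: "v \<in> Poly_Mapping.keys ((\<Sum>j\<le>m. w ^ j * cst (k j)) * r)"
    and d: "d \<in> S" "v = d + nmul n e1"
  have "(\<Sum>j\<le>m. w ^ j * cst (k j)) * r = (\<Sum>j\<le>m. Poly_Mapping.single (nmul j e2) (k j) * r)"
    by (simp add: sum_distrib_right mon_power mult_single)
  also have "Poly_Mapping.keys \<dots> \<subseteq> {x + nmul j e2 |x j. x \<in> Poly_Mapping.keys r}"
  proof (rule keys_sum_subset, rule subsetI)
    fix j x assume "x \<in> Poly_Mapping.keys (Poly_Mapping.single (nmul j e2) (k j) * r)"
    then obtain y where "y \<in> Poly_Mapping.keys r" "x = nmul j e2 + y" by (rule keys_single_mult_subset)
    then show "x \<in> {x + nmul j e2 |x j. x \<in> Poly_Mapping.keys r}" using add.commute by blast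
  qed
  finally obtain x j where x: "v = x + nmul j e2" "x \<in> Poly_Mapping.keys r" using v by blast
  have "x \<in> S" using x(2) r(1) by (auto simp: polys_def)
  then have "\<exists>d\<in>S. x = d + nmul n e1"
    by (rule parallelogram[OF _ d(1)]) (use x(1) d(2) in simp)
  then show False using r(2) x(2) unfolding reduced_def by blast
qed

lemma regular_sequence_in_maximalideal:
  fixes M :: "((nat \<times> nat) \<Rightarrow>\<^sub>0 'k::field) set"
  assumes max: "maximalideal M R"
  shows "\<exists>xs. regular_sequence R xs \<and> set xs \<subseteq> M \<and> length xs = 2"
proof -
  interpret R: cring "R :: ((nat \<times> nat) \<Rightarrow>\<^sub>0 'k) ring" by (rule cring_semigroup_ring)
  note M = maximalideal.axioms(1)[OF max]
  obtain n c where c: "c n \<noteq> 0" and pM: "(\<Sum>i\<le>n. u ^ i * cst (c i)) \<in> M"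
    by (rule maximalideal_contains_polynomial[OF max u_polys])
  obtain m k where k: "k m \<noteq> 0" and qM: "(\<Sum>j\<le>m. w ^ j * cst (k j)) \<in> M"
    by (rule maximalideal_contains_polynomial[OF max w_polys])
  let ?p = "\<Sum>i\<le>n. u ^ i * cst (c i)" and ?q = "\<Sum>j\<le>m. w ^ j * cst (k j)"
  have pC: "?p \<in> polys" and qC: "?q \<in> polys" using ideal_subset[OF M] pM qM by blast+
  have gen0: "genideal R {} = {0 :: (nat \<times> nat) \<Rightarrow>\<^sub>0 'k}"
  proof
    show "genideal R {} \<subseteq> {0 :: (nat \<times> nat) \<Rightarrow>\<^sub>0 'k}" using R.genideal_minimal[OF R.zeroideal, of "{}"] by simp
    show "{0 :: (nat \<times> nat) \<Rightarrow>\<^sub>0 'k} \<subseteq> genideal R {}" using ideal_zero[OF R.genideal_ideal[of "{}"]] by simp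
  qed
  have gen1: "genideal R {?p} = {a * ?p |a. a \<in> polys}"
    using R.cgenideal_eq_genideal[of ?p] pC by (simp add: cgenideal_def)
  have reg0: "a = 0" if "?p * a = 0" for a
    using poly_in_mon_mult_top[where c = c and n = n, OF e1_nz c, of a] that by auto
  have reg1: "a \<in> {a * ?p |a. a \<in> polys}" if a: "a \<in> polys" "?q * a \<in> {a * ?p |a. a \<in> polys}" for a
  proof -
    obtain b where b: "b \<in> polys" "?q * a = b * ?p" using a(2) by blast
    obtain s r where s: "s \<in> polys" "r \<in> polys" "reduced n r" "a = ?p * s + r"
      using division[where c = c and n = n, OF c, of a] a(1) by (auto simp: polys_def)
    have eq: "?p * (b - ?q * s) = ?q * r"
      using b(2) unfolding s(4) by (simp add: algebra_simps)
    have "reduced n (?p * (b - ?q * s))"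
      unfolding eq by (rule reduced_mult[OF s(2,3)])
    then have "b - ?q * s = 0"
      by (intro reduced_multiple_eq_0[where c = c and n = n, OF c] polys_diff polys_mult b(1) qC s(1))
    then have "?q * r = 0" using eq by simp
    then have "r = 0" using poly_in_mon_mult_top[where c = k and n = m, OF e2_nz k, of r] by auto
    then have "a = s * ?p" using s(4) by (simp add: mult.commute)
    then show ?thesis using s(1) by blast
  qed
  have "genideal R {?p, ?q} \<subseteq> M" by (rule R.genideal_minimal[OF M]) (use pM qM in simp)
  moreover have "M \<subset> carrier R" using maximalideal.I_notcarr[OF max] ideal_subset[OF M] by auto
  ultimately have proper: "genideal R {?p, ?q} \<noteq> carrier R" by blast
  have "regular_sequence R [?p, ?q]"
    unfolding regular_sequence_def
  proof (intro conjI allI impI ballI)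
    show "set [?p, ?q] \<subseteq> carrier R" using pC qC by simp
    show "genideal R (set [?p, ?q]) \<noteq> carrier R" using proper by simp
    fix i a assume i: "i < length [?p, ?q]" and a: "a \<in> carrier R"
      and mem: "[?p, ?q] ! i \<otimes>\<^bsub>R\<^esub> a \<in> genideal R (set (take i [?p, ?q]))"
    have "i = 0 \<or> i = 1" using i by auto
    then show "a \<in> genideal R (set (take i [?p, ?q]))"
    proof
      assume "i = 0"
      then show ?thesis using mem reg0 by (simp add: gen0)
    next
      assume i: "i = 1"
      have "a \<in> polys" using a by simp
      moreover have "?q * a \<in> genideal R {?p}" using mem i by simp
      ultimately have "a \<in> genideal R {?p}" unfolding gen1 by (rule reg1)
      then show ?thesis using i by simp
    qed
  qed
  moreover have "set [?p, ?q] \<subseteq> M" using pM qM by simp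
  ultimately show ?thesis by (intro exI[of _ "[?p, ?q]"]) simp
qed

theorem cohen_macaulay: "cohen_macaulay_semigroup TYPE('k::field) S"
  unfolding cohen_macaulay_semigroup_def
  by (rule cring.cohen_macaulay_ringI[OF cring_semigroup_ring noetherian_semigroup_ring
        krull_dim_le_2 regular_sequence_in_maximalideal])

end

section \<open>Monoids defined by a linear function modulo \<open>b\<close>\<close>

lemma lin_add: "lin c d (v + w) = lin c d v + lin c d w"
  by (simp add: lin_def algebra_simps)

lemma lin_nmul: "lin c d (nmul n v) = int n * lin c d v"
  by (simp add: lin_def nmul_def algebra_simps)

text \<open>
  Let \<open>e\<^sub>1 = (b, 0)\<close> and \<open>e\<^sub>2 = (- b g\<^sub>2, b g\<^sub>1)\<close>. A point of \<open>S\<close> can be moved back by \<open>e\<^sub>2\<close> whenever the coordinates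
  stay nonnegative, and by \<open>e\<^sub>1\<close> whenever its first coordinate and the value of \<open>g\<close> are large enough
  (\<open>g \<ge> b + b g\<^sub>1\<close> suffices, since afterwards \<open>g \<ge> b\<close> exceeds all remainders). The points where
  neither is possible are bounded.
\<close>

lemma cm_plane_monoid_of_inequality:
  fixes f1 f2 g1 g2 b :: int
  assumes b: "b > 0" and g1: "g1 > 0" and g2: "g2 \<le> 0"
  defines "S \<equiv> {v. lin f1 f2 v mod b \<le> lin g1 g2 v}"
  shows "\<exists>e1 e2 B. cm_plane_monoid S e1 e2 B"
proof -
  define e1 where "e1 = (nat b, 0 :: nat)"
  define e2 where "e2 = (nat (b * - g2), nat (b * g1))"
  have bg: "b * g1 > 0" "b * - g2 \<ge> 0" using b g1 g2 by (auto simp: mult_nonneg_nonpos mult_pos_pos mult_le_0_iff)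
  have fst2: "int (fst e2) = b * - g2" and snd2: "int (snd e2) = b * g1"
    using bg by (simp_all only: e2_def fst_conv snd_conv int_nat_eq) simp_all
  have f_e1: "lin f1 f2 e1 = b * f1" and g_e1: "lin g1 g2 e1 = b * g1"
    using b by (simp_all add: lin_def e1_def)
  have f_e2: "lin f1 f2 e2 = b * (f2 * g1 - f1 * g2)" and g_e2: "lin g1 g2 e2 = 0"
    unfolding lin_def fst2 snd2 by (simp_all add: algebra_simps)
  have S_iff: "v \<in> S \<longleftrightarrow> lin f1 f2 v mod b \<le> lin g1 g2 v" for v by (simp add: S_def)
  have S_nonneg: "lin g1 g2 v \<ge> 0" if "v \<in> S" for v
    using that pos_mod_sign[OF b, of "lin f1 f2 v"] unfolding S_iff by linarith
  have add_mem: "v + w \<in> S" if v: "v \<in> S" and w: "w \<in> S" for v w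
  proof -
    have "lin f1 f2 (v + w) mod b = (lin f1 f2 v mod b + lin f1 f2 w mod b) mod b"
      by (simp add: lin_add mod_add_eq)
    also have "\<dots> \<le> lin f1 f2 v mod b + lin f1 f2 w mod b"
      using b by (intro zmod_le_nonneg_dividend) simp
    finally show ?thesis using v w unfolding S_iff lin_add by linarith
  qed
  have e1S: "e1 \<in> S" using bg by (simp add: S_iff f_e1 g_e1)
  have e2S: "e2 \<in> S" by (simp add: S_iff f_e2 g_e2)
  \<comment> \<open>A bound for both coordinates of the points that can be moved back neither by \<open>e\<^sub>1\<close> nor by \<open>e\<^sub>2\<close>.\<close>
  define K where "K = b + b * g1 + b * g1 * - g2"
  define B where "B = S \<inter> ({..nat K} \<times> {..nat K})"
  have step: "\<exists>d\<in>S. v = d + e1 \<or> v = d + e2" if v: "v \<in> S" "v \<notin> B" for v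
  proof -
    let ?x = "int (fst v)" and ?y = "int (snd v)"
    have gv: "lin g1 g2 v = g1 * ?x + g2 * ?y" by (simp add: lin_def)
    show ?thesis
    proof (cases "fst e2 \<le> fst v \<and> snd e2 \<le> snd v")
      case True
      define d where "d = (fst v - fst e2, snd v - snd e2)"
      have vd: "v = d + e2" using True by (simp add: d_def prod_eq_iff)
      have "lin f1 f2 v mod b = lin f1 f2 d mod b" "lin g1 g2 v = lin g1 g2 d"
        unfolding vd lin_add f_e2 g_e2 by simp_all
      then have "d \<in> S" using v(1) by (simp add: S_iff)
      then show ?thesis using vd by blast
    next
      case False
      have pos: "b * g1 * - g2 \<ge> 0" by (rule mult_nonneg_nonneg[OF less_imp_le[OF bg(1)]]) (use g2 in simp)
      \<comment> \<open>Otherwise the first coordinate is too small to subtract \<open>e\<^sub>2\<close>, and \<open>g \<ge> 0\<close> bounds the second one.\<close>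
      have y_lt: "?y < b * g1"
      proof (rule ccontr)
        assume "\<not> ?y < b * g1"
        then have "int (snd e2) \<le> ?y" unfolding snd2 by simp
        then have x_lt: "?x < b * - g2" using False unfolding fst2[symmetric] by simp
        then have g2': "- g2 \<ge> 1" using g2 by (cases "g2 = 0") auto
        have "1 * ?y \<le> - g2 * ?y" using g2' by (intro mult_right_mono) auto
        moreover have "- g2 * ?y \<le> g1 * ?x" using S_nonneg[OF v(1)] by (simp add: gv)
        moreover have "g1 * ?x \<le> g1 * (b * - g2)" using x_lt g1 by (intro mult_left_mono) auto
        ultimately have "?y \<le> b * g1 * - g2" by (simp add: mult_ac)
        moreover have "?x \<le> b * g1 * - g2"
        proof -
          have "1 * (b * - g2) \<le> g1 * (b * - g2)" using g1 bg(2) by (intro mult_right_mono) auto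
          then show ?thesis using x_lt by (simp add: mult_ac)
        qed
        ultimately have "v \<in> B"
          using v(1) b bg(1) by (auto simp: B_def K_def mem_Times_iff nat_le_iff le_nat_iff)
        then show False using v(2) by simp
      qed
      have big: "?x \<ge> b \<and> g1 * ?x + g2 * ?y \<ge> b + b * g1"
      proof (rule ccontr)
        assume no: "\<not> ?thesis"
        have "?x \<le> K"
        proof (cases "?x < b")
          case True
          then show ?thesis using bg(1) pos by (simp add: K_def)
        next
          case False
          then have "g1 * ?x < b + b * g1 + - g2 * ?y" using no by simp
          moreover have "1 * ?x \<le> g1 * ?x" using g1 by (intro mult_right_mono) auto
          moreover have "- g2 * ?y \<le> - g2 * (b * g1)" using y_lt g2 by (intro mult_left_mono) auto
          moreover have "- g2 * (b * g1) = b * g1 * - g2" by (simp only: mult.commute)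
          ultimately show ?thesis unfolding K_def by linarith
        qed
        moreover have "?y \<le> K" using y_lt pos b by (simp add: K_def)
        ultimately have "v \<in> B" using v(1) by (auto simp: B_def mem_Times_iff le_nat_iff)
        then show False using v(2) by simp
      qed
      define d where "d = (fst v - fst e1, snd v)"
      have vd: "v = d + e1" using big b by (simp add: d_def e1_def prod_eq_iff nat_le_iff)
      have "lin f1 f2 v mod b = lin f1 f2 d mod b" "lin g1 g2 v = lin g1 g2 d + b * g1"
        unfolding vd lin_add f_e1 g_e1 by simp_all
      moreover have "lin f1 f2 d mod b < b" using b by simp
      ultimately have "d \<in> S" using big unfolding S_iff gv by linarith
      then show ?thesis using vd by blast
    qed
  qed
  have "cm_plane_monoid S e1 e2 B"
  proof
    show "0 \<in> S" by (simp add: S_iff lin_def)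
    show "v + w \<in> S" if "v \<in> S" "w \<in> S" for v w by (rule add_mem[OF that])
    show "e1 \<in> S" "e2 \<in> S" by fact+
    show e1_nz: "e1 \<noteq> 0" using b by (simp add: e1_def zero_prod_def)
    show e2_nz: "e2 \<noteq> 0" using bg(1) snd2 by (auto simp: zero_prod_def)
    show "finite B" "B \<subseteq> S" by (auto simp: B_def)
    show "\<exists>s\<in>B. \<exists>x y. v = s + nmul x e1 + nmul y e2" if "v \<in> S" for v
      using that
    proof (induction "coord_sum v" arbitrary: v rule: less_induct)
      case less
      show ?case
      proof (cases "v \<in> B")
        case True
        then show ?thesis by (intro bexI[of _ v] exI[of _ 0]) simp_all
      next
        case False
        then obtain d where d: "d \<in> S" "v = d + e1 \<or> v = d + e2" using step less.prems by blast
        then have "coord_sum d < coord_sum v" using coord_sum_pos[OF e1_nz] coord_sum_pos[OF e2_nz] by auto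
        then obtain s x y where s: "s \<in> B" "d = s + nmul x e1 + nmul y e2" using less.hyps d(1) by blast
        from d(2) show ?thesis
        proof
          assume "v = d + e1"
          then have "v = s + nmul (Suc x) e1 + nmul y e2"
            using nmul_add[of "Suc 0" x e1] by (simp add: s(2) nmul_1 ac_simps)
          then show ?thesis using s(1) by blast
        next
          assume "v = d + e2"
          then have "v = s + nmul x e1 + nmul (Suc y) e2"
            using nmul_add[of "Suc 0" y e2] by (simp add: s(2) nmul_1 ac_simps)
          then show ?thesis using s(1) by blast
        qed
      qed
    qed
    show "\<exists>d\<in>S. a = d + nmul x e1" if a: "a \<in> S" and c: "c \<in> S" and eq: "a + nmul y e2 = c + nmul x e1"
      for a c x y
    proof -
      have f: "lin f1 f2 a + int y * (b * (f2 * g1 - f1 * g2)) = lin f1 f2 c + int x * (b * f1)"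
        using arg_cong[OF eq, of "lin f1 f2"] by (simp add: lin_add lin_nmul f_e1 f_e2)
      have g: "lin g1 g2 a = lin g1 g2 c + int x * (b * g1)"
        using arg_cong[OF eq, of "lin g1 g2"] by (simp add: lin_add lin_nmul g_e1 g_e2)
      \<comment> \<open>Since \<open>g\<close> takes the same value at \<open>a - x e\<^sub>1\<close> and at \<open>c\<close>, nonnegativity of \<open>g c\<close> makes the first
          coordinate of \<open>a - x e\<^sub>1\<close> nonnegative.\<close>
      have "g1 * (int x * b) \<le> g1 * int (fst a) + g2 * int (snd a)"
        using g S_nonneg[OF c] by (simp add: lin_def mult_ac)
      also have "\<dots> \<le> g1 * int (fst a)" using g2 by (simp add: mult_nonpos_nonneg)
      finally have "int x * b \<le> int (fst a)" using g1 by simp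
      then have le: "x * nat b \<le> fst a"
        using b by (metis int_nat_eq less_imp_le of_nat_le_iff of_nat_mult)
      define d where "d = (fst a - x * nat b, snd a)"
      have ad: "a = d + nmul x e1" using le by (simp add: d_def e1_def nmul_def prod_eq_iff)
      have "lin g1 g2 d = lin g1 g2 c" using g unfolding ad lin_add lin_nmul g_e1 by simp
      moreover have "lin f1 f2 d + b * (int y * (f2 * g1 - f1 * g2)) = lin f1 f2 c"
        using f unfolding ad lin_add lin_nmul f_e1 by (simp add: algebra_simps)
      then have "lin f1 f2 c mod b = lin f1 f2 d mod b" by (metis mod_mult_self2)
      ultimately have "d \<in> S" using c by (simp add: S_iff)
      then show ?thesis using ad by blast
    qed
  qed
  then show ?thesis by blast
qed

lemma swap_add: "prod.swap (v + w) = prod.swap v + (prod.swap w :: 'a::plus \<times> 'b::plus)"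
  by (simp add: prod.swap_def)

lemma swap_nmul: "prod.swap (nmul n v) = nmul n (prod.swap v)"
  by (simp add: nmul_def)

lemma cm_plane_monoid_swap:
  assumes "cm_plane_monoid S e1 e2 B"
  shows "cm_plane_monoid (prod.swap ` S) (prod.swap e1) (prod.swap e2) (prod.swap ` B)"
proof -
  interpret cm_plane_monoid S e1 e2 B by fact
  have mem: "v \<in> prod.swap ` S \<longleftrightarrow> prod.swap v \<in> S" for v :: "nat \<times> nat" by force
  have nz: "prod.swap e \<noteq> 0" if "e \<noteq> 0" for e :: "nat \<times> nat"
    using that by (cases e) (auto simp: zero_prod_def)
  show ?thesis
  proof
    show "0 \<in> prod.swap ` S" using zero_mem by (simp add: mem zero_prod_def)
    show "v + w \<in> prod.swap ` S" if "v \<in> prod.swap ` S" "w \<in> prod.swap ` S" for v w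
      using that add_mem by (simp add: mem swap_add)
    show "prod.swap e1 \<in> prod.swap ` S" "prod.swap e2 \<in> prod.swap ` S"
      using e1_mem e2_mem by auto
    show "prod.swap e1 \<noteq> 0" "prod.swap e2 \<noteq> 0" using nz e1_nz e2_nz by blast+
    show "finite (prod.swap ` B)" "prod.swap ` B \<subseteq> prod.swap ` S"
      using finite_B B_subset by auto
    show "\<exists>s\<in>prod.swap ` B. \<exists>x y. v = s + nmul x (prod.swap e1) + nmul y (prod.swap e2)"
      if v: "v \<in> prod.swap ` S" for v
    proof -
      obtain s x y where s: "s \<in> B" "prod.swap v = s + nmul x e1 + nmul y e2"
        using decompose v unfolding mem by blast
      have "v = prod.swap s + nmul x (prod.swap e1) + nmul y (prod.swap e2)"
        using arg_cong[OF s(2), of prod.swap] by (simp add: swap_add swap_nmul)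
      then show ?thesis using s(1) by blast
    qed
    show "\<exists>d\<in>prod.swap ` S. a = d + nmul x (prod.swap e1)"
      if a: "a \<in> prod.swap ` S" and c: "c \<in> prod.swap ` S"
        and eq: "a + nmul y (prod.swap e2) = c + nmul x (prod.swap e1)" for a c x y
    proof -
      have "prod.swap a + nmul y e2 = prod.swap c + nmul x e1"
        using arg_cong[OF eq, of prod.swap] by (simp add: swap_add swap_nmul)
      then obtain d where d: "d \<in> S" "prod.swap a = d + nmul x e1"
        using parallelogram a c unfolding mem by blast
      have "a = prod.swap d + nmul x (prod.swap e1)"
        using arg_cong[OF d(2), of prod.swap] by (simp add: swap_add swap_nmul)
      then show ?thesis using d(1) by blast
    qed
  qed
qed

theorem corollary12:
  fixes f1 f2 g1 g2 b :: int
    and S :: "(nat \<times> nat) set"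
  assumes "f1 \<noteq> 0 \<or> f2 \<noteq> 0"
    and "g1 \<noteq> 0 \<or> g2 \<noteq> 0"
    and "b > 0"
    and "S = {v. lin f1 f2 v mod b \<le> lin g1 g2 v}"
    and "g1 * g2 \<le> 0"
    and "\<not> (g1 \<le> 0 \<and> g2 \<le> 0)"
    and "S \<noteq> UNIV"
  shows "cohen_macaulay_semigroup TYPE('k::field) S"
proof -
  have "\<exists>e1 e2 B. cm_plane_monoid S e1 e2 B"
  proof (cases "g1 > 0")
    case True
    then have "g2 \<le> 0" using assms(5) by (simp add: mult_le_0_iff)
    then show ?thesis
      unfolding assms(4) by (rule cm_plane_monoid_of_inequality[OF assms(3) True])
  next
    case False
    then have "g2 > 0" "g1 \<le> 0" using assms(6) by auto
    from cm_plane_monoid_of_inequality[OF assms(3) this, of f2 f1]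
    obtain e1 e2 B where "cm_plane_monoid {v. lin f2 f1 v mod b \<le> lin g2 g1 v} e1 e2 B" by blast
    then have "cm_plane_monoid (prod.swap ` {v. lin f2 f1 v mod b \<le> lin g2 g1 v})
        (prod.swap e1) (prod.swap e2) (prod.swap ` B)" by (rule cm_plane_monoid_swap)
    moreover have "prod.swap ` {v. lin f2 f1 v mod b \<le> lin g2 g1 v} = S"
      unfolding assms(4) by (force simp: lin_def add.commute)
    ultimately show ?thesis by metis
  qed
  then show ?thesis using cm_plane_monoid.cohen_macaulay by blast
qed

end
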